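(* Let $\mu,\nu\in\mathcal M$ with $\mu(\mathbb R)=\nu(\mathbb R)$ and $\min\{p_{\mu,\nu},c_{\mu,\nu}\}>0$. Let $T^*$ be the optimal map for $(\mu,\nu)$, $T^-$ the optimal map for $(\eta^-,\chi^-)$ and $T^+$ the optimal map for $(\eta^+,\chi^+)$. Define $\hat T:\mathbb R\to\mathbb R$ by $$\hat T(x)=\begin{cases}T^-(x),& x<x^-,\\ x,& x^-\le x\le x^+,\\ T^+(x),& x>x^+.\end{cases}$$ Then $T^*=\hat T$ $\mu$-a.e.
   Context: $\mathcal M$ is the set of Borel measures $\eta$ on $\mathbb R$ with $\eta(\mathbb R)<\infty$ and $\int|x|\,\eta(dx)<\infty$. For $\eta\in\mathcal M$: $P_\eta(k)=\int(k-x)^+\eta(dx)$, $C_\eta(k)=\int(x-k)^+\eta(dx)$. $\eta\le_c\chi$ means $\int f\,d\eta\le\int f\,d\chi$ for all convex $f:\mathbb R\to\mathbb R$. For $\eta,\chi\in\mathcal M$ of equal mass, $\Pi(\eta,\chi)$ is the set of measures on $\mathbb R^2$ with marginals $\eta,\chi$; $\pi(dx,dy)=\pi_x(dy)\eta(dx)$ denotes disintegration. For convex $h:\mathbb R\to[0,\infty)$ with $h(0)=0$, $$V_h(\eta,\chi)=\inf_{\pi\in\Pi(\eta,\chi)}\int h\Big(x-\int y\,\pi_x(dy)\Big)\eta(dx),\qquad \bar V_h(\eta,\chi)=\inf_{\pi\in\Pi(\eta,\chi)}\int h(x-y)\,\pi(dx,dy).$$ For $\eta,\chi\in\mathcal M$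 of equal mass, a map $S:\mathbb R\to\mathbb R$ is admissible w.r.t. $(\eta,\chi)$ if it is non-decreasing, $1$-Lipschitz, and the push-forward $S(\eta)$ satisfies $S(\eta)\le_c\chi$. It is known (previous work) that there is an admissible map $T$, unique up to $\eta$-a.e. equality, such that $V_h(\eta,\chi)=\bar V_h(\eta,T(\eta))$ for all convex $h:\mathbb R\to[0,\infty)$ with $h(0)=0$; it is called the optimal map for $(\eta,\chi)$. It is also characterized ($\eta$-a.e.) by either of: (1) $S(\eta)\le_c T(\eta)\le_c\chi$ for all admissible $S$; (2) $T$ is admissible and has slope $1$ on each interval $T^{-1}(I)$, where $I$ is any irreducible interval of $(T(\eta),\chi)$, i.e. any connected component of the open set $\{k:P_{T(\eta)}(k)<P_\chi(k)\}$. Fix $\mu,\nu\in\mathcal M$ of equal mass. Let $p_{\mu,\nu}=\sup_k\{P_\mu(k)-P_\nu(k)\}$, $c_{\mu,\nu}=\sup_k\{C_\mu(k)-C_\nu(k)\}$. If both are $>0$, put $\tilde P=P_\nu+p_{\mu,\nu}$, $$x^-=\inf\{k:\tilde P(k)=P_\mu(k)\},\qquad x^+=\sup\{k:\tilde P(k)=P_\mu(k)\}$$ (real numbers with $x^-\le x^+$), $\Delta^-=P_\mu'(x^--)$ (left derivative), $\Delta^+=P_\mu'(x^++)$ (right derivative), and $$\eta^-=\mu|_{(-\infty,x^-)},\quad \eta^+=\mu|_{(x^+,\infty)},$$ $$\chi^-=\nu|_{(-\infty,x^-)}+\big(\Delta^--\tilde P'(x^--)\big)\delta_{x^-},\quad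 \chi^+=\nu|_{(x^+,\infty)}+\big(\tilde P'(x^++)-\Delta^+\big)\delta_{x^+}.$$ Then $\chi^\pm(\mathbb R)=\eta^\pm(\mathbb R)$. *)

theory Defs
  imports "HOL-Probability.Probability"
begin

definition finite_first_moment_measures :: "real measure set" ("\<M>") where
  "\<M> = {\<eta>. sets \<eta> = sets borel \<and> emeasure \<eta> UNIV < \<infinity> \<and> integrable \<eta> (\<lambda>x. \<bar>x\<bar>)}"

definition put_fun :: "real measure \<Rightarrow> real \<Rightarrow> real" where
  "put_fun \<eta> k = (LINT x|\<eta>. max (k - x) 0)"

definition call_fun :: "real measure \<Rightarrow> real \<Rightarrow> real" where
  "call_fun \<eta> k = (LINT x|\<eta>. max (x - k) 0)"

text \<open>
  The Bochner integral is 0 for non-integrable functions, so it cannot be used to integrate an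
  arbitrary convex function. The following integral takes values in the extended reals. A convex
  function is bounded below by an affine one, hence for measures in \<open>\<M>\<close> the second term
  (the integral of the negative part; \<^const>\<open>ennreal\<close> truncates negative reals to 0) is finite.
\<close>

definition extended_integral :: "real measure \<Rightarrow> (real \<Rightarrow> real) \<Rightarrow> ereal" where
  "extended_integral \<eta> f =
     enn2ereal (\<integral>\<^sup>+ x. ennreal (f x) \<partial>\<eta>) - enn2ereal (\<integral>\<^sup>+ x. ennreal (- f x) \<partial>\<eta>)"

definition convex_order :: "real measure \<Rightarrow> real measure \<Rightarrow> bool" (infix "\<le>\<^sub>c" 50) where
  "\<eta> \<le>\<^sub>c \<xi> \<longleftrightarrow>
     (\<forall>f. convex_on UNIV f \<longrightarrow> extended_integral \<eta> f \<le> extended_integral \<xi> f)"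

definition couplings :: "real measure \<Rightarrow> real measure \<Rightarrow> (real \<times> real) measure set" where
  "couplings \<eta> \<xi> = {\<pi>. sets \<pi> = sets borel \<and> distr \<pi> borel fst = \<eta> \<and> distr \<pi> borel snd = \<xi>}"

definition disintegration :: "(real \<times> real) measure \<Rightarrow> real measure \<Rightarrow> (real \<Rightarrow> real measure) \<Rightarrow> bool" where
  "disintegration \<pi> \<eta> \<kappa> \<longleftrightarrow>
     \<kappa> \<in> borel \<rightarrow>\<^sub>M prob_algebra borel \<and>
     (\<forall>A \<in> sets borel. emeasure \<pi> A = (\<integral>\<^sup>+ x. emeasure (\<kappa> x) {y. (x, y) \<in> A} \<partial>\<eta>))"

definition cost_function :: "(real \<Rightarrow> real) \<Rightarrow> bool" where
  "cost_function h \<longleftrightarrow> convex_on UNIV h \<and> (\<forall>x. 0 \<le> h x) \<and> h 0 = 0"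

text \<open>
  The disintegration of a coupling is unique only almost everywhere. The integral does not depend
  on the version, so the infimum is taken over all couplings together with all their
  disintegrations. The barycentre of \<open>\<kappa> x\<close> exists for almost every \<open>x\<close> if the second marginal has
  a finite first moment.
\<close>

definition weak_transport_cost :: "(real \<Rightarrow> real) \<Rightarrow> real measure \<Rightarrow> real measure \<Rightarrow> ennreal" where
  "weak_transport_cost h \<eta> \<xi> =
     (INF (\<pi>, \<kappa>) \<in> {(\<pi>, \<kappa>). \<pi> \<in> couplings \<eta> \<xi> \<and> disintegration \<pi> \<eta> \<kappa>}.
        \<integral>\<^sup>+ x. ennreal (h (x - (LINT y|\<kappa> x. y))) \<partial>\<eta>)"

definition transport_cost :: "(real \<Rightarrow> real) \<Rightarrow> real measure \<Rightarrow> real measure \<Rightarrow> ennreal" where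
  "transport_cost h \<eta> \<xi> =
     (INF \<pi> \<in> couplings \<eta> \<xi>. \<integral>\<^sup>+ (x, y). ennreal (h (x - y)) \<partial>\<pi>)"

definition admissible :: "real measure \<Rightarrow> real measure \<Rightarrow> (real \<Rightarrow> real) \<Rightarrow> bool" where
  "admissible \<eta> \<xi> S \<longleftrightarrow> mono S \<and> 1-lipschitz_on UNIV S \<and> distr \<eta> borel S \<le>\<^sub>c \<xi>"

definition optimal_map :: "real measure \<Rightarrow> real measure \<Rightarrow> (real \<Rightarrow> real) \<Rightarrow> bool" where
  "optimal_map \<eta> \<xi> T \<longleftrightarrow> admissible \<eta> \<xi> T \<and>
     (\<forall>h. cost_function h \<longrightarrow> weak_transport_cost h \<eta> \<xi> = transport_cost h \<eta> (distr \<eta> borel T))"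

definition p_gap :: "real measure \<Rightarrow> real measure \<Rightarrow> real" where
  "p_gap \<mu> \<nu> = (SUP k. put_fun \<mu> k - put_fun \<nu> k)"

definition c_gap :: "real measure \<Rightarrow> real measure \<Rightarrow> real" where
  "c_gap \<mu> \<nu> = (SUP k. call_fun \<mu> k - call_fun \<nu> k)"

definition shifted_put :: "real measure \<Rightarrow> real measure \<Rightarrow> real \<Rightarrow> real" where
  "shifted_put \<mu> \<nu> k = put_fun \<nu> k + p_gap \<mu> \<nu>"

definition x_minus :: "real measure \<Rightarrow> real measure \<Rightarrow> real" where
  "x_minus \<mu> \<nu> = Inf {k. shifted_put \<mu> \<nu> k = put_fun \<mu> k}"

definition x_plus :: "real measure \<Rightarrow> real measure \<Rightarrow> real" where
  "x_plus \<mu> \<nu> = Sup {k. shifted_put \<mu> \<nu> k = put_fun \<mu> k}"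

definition left_deriv :: "(real \<Rightarrow> real) \<Rightarrow> real \<Rightarrow> real" where
  "left_deriv f x = vector_derivative f (at_left x)"

definition right_deriv :: "(real \<Rightarrow> real) \<Rightarrow> real \<Rightarrow> real" where
  "right_deriv f x = vector_derivative f (at_right x)"

definition Delta_minus :: "real measure \<Rightarrow> real measure \<Rightarrow> real" where
  "Delta_minus \<mu> \<nu> = left_deriv (put_fun \<mu>) (x_minus \<mu> \<nu>)"

definition Delta_plus :: "real measure \<Rightarrow> real measure \<Rightarrow> real" where
  "Delta_plus \<mu> \<nu> = right_deriv (put_fun \<mu>) (x_plus \<mu> \<nu>)"

text \<open>
  Restriction of a measure to a Borel set, regarded again as a measure on the whole line
  (\<^const>\<open>restrict_space\<close> would change the underlying space).
\<close>

definition restrict_measure :: "real measure \<Rightarrow> real set \<Rightarrow> real measure" where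
  "restrict_measure \<eta> A = density \<eta> (indicator A)"

definition add_dirac :: "real measure \<Rightarrow> real \<Rightarrow> real \<Rightarrow> real measure" where
  "add_dirac \<eta> w a =
     measure_of UNIV (sets borel) (\<lambda>A. emeasure \<eta> A + ennreal w * emeasure (return borel a) A)"

lemma sets_add_dirac [simp]: "sets (add_dirac \<eta> w a) = sets borel"
  unfolding add_dirac_def
  by (metis sets.sigma_sets_eq sets_measure_of space_borel subset_UNIV Pow_UNIV)

lemma emeasure_add_dirac:
  assumes "sets \<eta> = sets borel" "A \<in> sets borel"
  shows "emeasure (add_dirac \<eta> w a) A = emeasure \<eta> A + ennreal w * indicator A a"
proof -
  let ?f = "\<lambda>A. emeasure \<eta> A + ennreal w * emeasure (return borel a) A"
  have "countably_additive (sets (add_dirac \<eta> w a)) ?f"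
  proof (rule countably_additiveI)
    fix B :: "nat \<Rightarrow> real set"
    assume B: "range B \<subseteq> sets (add_dirac \<eta> w a)" "disjoint_family B"
    have 1: "(\<Sum>i. emeasure \<eta> (B i)) = emeasure \<eta> (\<Union>i. B i)"
      using B assms(1) by (intro suminf_emeasure) auto
    have 2: "(\<Sum>i. emeasure (return borel a) (B i)) = emeasure (return borel a) (\<Union>i. B i)"
      using B by (intro suminf_emeasure) auto
    show "(\<Sum>i. ?f (B i)) = ?f (\<Union>i. B i)"
      by (simp add: suminf_add[symmetric] ennreal_suminf_cmult 1 2)
  qed
  then have "emeasure (add_dirac \<eta> w a) A = ?f A"
    by (intro emeasure_measure_of[OF add_dirac_def])
       (use assms in \<open>auto simp: positive_def\<close>)
  then show ?thesis using assms by simp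
qed

definition eta_minus :: "real measure \<Rightarrow> real measure \<Rightarrow> real measure" where
  "eta_minus \<mu> \<nu> = restrict_measure \<mu> {..<x_minus \<mu> \<nu>}"

definition eta_plus :: "real measure \<Rightarrow> real measure \<Rightarrow> real measure" where
  "eta_plus \<mu> \<nu> = restrict_measure \<mu> {x_plus \<mu> \<nu><..}"

definition chi_minus :: "real measure \<Rightarrow> real measure \<Rightarrow> real measure" where
  "chi_minus \<mu> \<nu> = add_dirac (restrict_measure \<nu> {..<x_minus \<mu> \<nu>})
     (Delta_minus \<mu> \<nu> - left_deriv (shifted_put \<mu> \<nu>) (x_minus \<mu> \<nu>)) (x_minus \<mu> \<nu>)"

definition chi_plus :: "real measure \<Rightarrow> real measure \<Rightarrow> real measure" where
  "chi_plus \<mu> \<nu> = add_dirac (restrict_measure \<nu> {x_plus \<mu> \<nu><..})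
     (right_deriv (shifted_put \<mu> \<nu>) (x_plus \<mu> \<nu>) - Delta_plus \<mu> \<nu>) (x_plus \<mu> \<nu>)"

definition glued_map ::
  "real measure \<Rightarrow> real measure \<Rightarrow> (real \<Rightarrow> real) \<Rightarrow> (real \<Rightarrow> real) \<Rightarrow> real \<Rightarrow> real" where
  "glued_map \<mu> \<nu> Tminus Tplus x =
     (if x < x_minus \<mu> \<nu> then Tminus x else if x \<le> x_plus \<mu> \<nu> then x else Tplus x)"

end

theory Submission
  imports Defs
begin

text \<open>
  By Strassen's theorem, every \<open>S\<close> with \<open>S(\<mu>) \<le>\<^sub>c \<nu>\<close> is, up to an arbitrarily small error in \<open>L\<^sup>1\<close>, the
  barycentre map of a coupling of \<open>\<mu>\<close> and \<open>\<nu>\<close>. As the coupling induced by a non-decreasing \<open>1\<close>-Lipschitz map is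
  optimal, an optimal map \<open>T\<close> minimises \<open>\<integral> h (x - S x) \<mu>(dx)\<close> over all these \<open>S\<close>. It suffices to
  use the hinge costs \<open>h z = (s (z - c))\<^sup>+\<close> with \<open>s = \<plusminus>1\<close> and \<open>s c \<ge> 0\<close>.

  For \<open>h z = (- z)\<^sup>+\<close> the competitor that clamps \<open>x\<close> to an interval \<open>[c, d]\<close> with
  \<open>P\<^sub>\<mu> c = p\<^bsub>\<mu>,\<nu>\<^esub>\<close> and \<open>C\<^sub>\<mu> d = c\<^bsub>\<mu>,\<nu>\<^esub>\<close> has cost \<open>p\<^bsub>\<mu>,\<nu>\<^esub>\<close>. On the other hand, a map whose
  image of \<open>\<mu>\<close> is dominated by \<open>\<nu>\<close> costs at least \<open>P\<^sub>\<mu> k - P\<^sub>\<nu> k\<close> for every \<open>k\<close>, which is \<open>p\<^bsub>\<mu>,\<nu>\<^esub>\<close>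
  at \<open>k = x\<^sup>-\<close> and \<open>k = x\<^sup>+\<close>. The equality case says that the optimal map moves no mass across
  \<open>x\<^sup>\<plusminus>\<close> and is the identity in between. Its restrictions to both sides are then competitors of
  \<open>T\<^sup>\<plusminus>\<close> and vice versa, and the minimiser of all hinge costs is unique almost everywhere.
\<close>

section \<open>Measures with finite first moment\<close>

text \<open>The competitors are the maps in \<open>dominated_map\<close>, a larger class than the
  admissible ones: they can be pasted along a Borel set with no check of monotonicity or Lipschitz
  continuity at the seam, so that the glued map itself never has to be shown admissible. The two
  bounds on the cost are of different nature. The lower bound uses that the optimal map is monotone
  and 1-Lipschitz and comes from explicit dual potentials. The upper bound has to realise a
  prescribed map by barycentres of kernels, which for an image of infinite support would require a
  limit of kernels. Only an inequality between costs is wanted, however, and it survives limits in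
  L1. So finitely many barycentres suffice, and these are served one after another with parts of the
  target measure. A hinge is not strictly convex, hence no single hinge cost identifies the optimal
  map. The whole family does: a disagreement of two minimisers is detected by any kink that lies
  strictly between the two displacements.\<close>

lemma finite_first_moment_measuresD:
  assumes "\<eta> \<in> \<M>"
  shows "sets \<eta> = sets borel" "space \<eta> = UNIV" "finite_measure \<eta>" "integrable \<eta> (\<lambda>x. x)"
proof -
  show s: "sets \<eta> = sets borel" and sp: "space \<eta> = UNIV"
    using assms sets_eq_imp_space_eq[of \<eta> borel] by (auto simp: finite_first_moment_measures_def)
  show "finite_measure \<eta>"
    using assms sp by (intro finite_measureI) (auto simp: finite_first_moment_measures_def)
  have "(\<lambda>x. x) \<in> borel_measurable \<eta>"
    using s by (simp add: measurable_ident_sets)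
  then show "integrable \<eta> (\<lambda>x. x)"
    using assms integrable_abs_cancel[of \<eta> "\<lambda>x. x"] by (auto simp: finite_first_moment_measures_def)
qed

lemma finite_first_moment_measuresI:
  assumes "sets \<eta> = sets borel" "finite_measure \<eta>" "integrable \<eta> (\<lambda>x. x)"
  shows "\<eta> \<in> \<M>"
proof -
  have "space \<eta> = UNIV"
    using assms(1) sets_eq_imp_space_eq[of \<eta> borel] by auto
  then have "emeasure \<eta> UNIV \<noteq> \<infinity>"
    using assms(2) finite_measure.emeasure_finite[of \<eta> UNIV] by simp
  then show ?thesis
    using assms unfolding finite_first_moment_measures_def by (auto simp: top.not_eq_extremum)
qed

lemma integrable_put_call:
  fixes S :: "'a \<Rightarrow> real"
  assumes "finite_measure \<eta>" "integrable \<eta> S"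
  shows "integrable \<eta> (\<lambda>x. max (k - S x) 0)" "integrable \<eta> (\<lambda>x. max (S x - k) 0)"
  using assms by (auto intro!: integrable_max integrable_diff finite_measure.integrable_const)

lemma put_call_parity:
  fixes S :: "'a \<Rightarrow> real"
  assumes "finite_measure \<eta>" "integrable \<eta> S"
  shows "(LINT x|\<eta>. max (S x - k) 0) =
    (LINT x|\<eta>. max (k - S x) 0) - k * measure \<eta> (space \<eta>) + (LINT x|\<eta>. S x)"
proof -
  interpret finite_measure \<eta> by fact
  have "(LINT x|\<eta>. max (S x - k) 0) = (LINT x|\<eta>. max (k - S x) 0 - k + S x)"
    by (rule Bochner_Integration.integral_cong) (auto simp: max_def)
  also have "\<dots> = (LINT x|\<eta>. max (k - S x) 0) - k * measure \<eta> (space \<eta>) + (LINT x|\<eta>. S x)"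
    using assms integrable_put_call[OF assms, of k] by (simp add: mult.commute)
  finally show ?thesis .
qed

lemma integral_indicator_measure:
  assumes "\<eta> \<in> \<M>" "A \<in> sets borel"
  shows "(LINT x|\<eta>. indicator A x * c) = c * measure \<eta> A" "integrable \<eta> (\<lambda>x. indicator A x * (c :: real))"
proof -
  note D = finite_first_moment_measuresD[OF assms(1)]
  interpret finite_measure \<eta> by (rule D)
  have "integrable \<eta> (indicator A :: real \<Rightarrow> real)"
    using assms(2) D by (intro integrable_real_indicator) (auto simp: emeasure_eq_measure)
  then show "(LINT x|\<eta>. indicator A x * c) = c * measure \<eta> A" "integrable \<eta> (\<lambda>x. indicator A x * c)"
    using D(2) by simp_all
qed

text \<open>Passing from points to levels in the interval from 0 to the total mass makes it possible
  to cut an atom into pieces, which subsets of the real line cannot do. The construction of shadows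
  relies on this.\<close>

lemma quantile_representation:
  fixes \<eta> :: "real measure"
  assumes "finite_measure \<eta>" "sets \<eta> = sets borel"
  obtains q where "q \<in> borel_measurable borel" "mono_on {0<..<measure \<eta> UNIV} q"
    "\<eta> = distr (restrict_space lborel {0<..<measure \<eta> UNIV}) borel q"
proof -
  define m where "m = measure \<eta> UNIV"
  interpret finite_measure \<eta> by fact
  interpret finite_borel_measure \<eta>
    by unfold_locales (use assms in auto)
  interpret F: right_continuous_mono "cdf \<eta>" 0 m
    by standard
      (use cdf_nondecreasing cdf_is_right_cont cdf_lim_at_top cdf_lim_at_bot borel_UNIV
        in \<open>auto intro!: monoI simp: m_def\<close>)
  \<comment> \<open>The generalised inverse of the cdf, set to 0 off the interval of levels so that
    it is Borel on the whole line.\<close>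
  define q where "q u = indicator {0<..<m} u * F.I u" for u
  have q_eq: "q u = F.I u" if "u \<in> {0<..<m}" for u
    using that by (simp add: q_def)
  have "F.I \<in> borel_measurable (restrict_space borel {0<..<m})"
    by (intro borel_measurable_mono_on_fnc F.mono_I)
  then have meas: "q \<in> borel_measurable borel"
    unfolding q_def using borel_measurable_restrict_space_iff[of "{0<..<m}" borel F.I]
    by (simp add: ac_simps)
  have mono: "mono_on {0<..<m} q"
    using F.mono_I by (auto simp: mono_on_def q_eq)
  let ?\<Omega> = "restrict_space lborel {0<..<m}"
  have meas_\<Omega>: "q \<in> measurable ?\<Omega> borel"
    using meas by (intro measurable_restrict_space1) simp
  have eq: "\<eta> = distr ?\<Omega> borel q"
  proof (rule measure_eqI_lessThan)
    have lt: "emeasure (distr ?\<Omega> borel q) {x<..} = emeasure lborel {u\<in>{0<..<m}. x < q u}" for x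
    proof -
      have "emeasure (distr ?\<Omega> borel q) {x<..} = emeasure ?\<Omega> {u\<in>{0<..<m}. x < q u}"
        by (subst emeasure_distr[OF meas_\<Omega>])
           (auto simp: space_restrict_space intro!: arg_cong2[where f=emeasure])
      also have "\<dots> = emeasure lborel {u\<in>{0<..<m}. x < q u}"
        by (rule emeasure_restrict_space) auto
      finally show ?thesis .
    qed
    fix x
    have le: "emeasure lborel {u\<in>{0<..<m}. x < q u} = ennreal (m - cdf \<eta> x)"
    proof -
      have "cdf \<eta> x \<le> m" "0 \<le> cdf \<eta> x"
        using cdf_bounded[of x] cdf_nonneg[of x] borel_UNIV by (simp_all add: m_def)
      moreover have "{u\<in>{0<..<m}. x < q u} = {cdf \<eta> x<..<m}"
      proof -
        have "x < q u \<longleftrightarrow> cdf \<eta> x < u" if "0 < u" "u < m" for u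
          using F.pseudoinverse[OF that, of x] q_eq[of u] that by (simp add: not_le[symmetric])
        then show ?thesis
          using \<open>0 \<le> cdf \<eta> x\<close> by (auto intro: le_less_trans)
      qed
      ultimately show ?thesis by simp
    qed
    have "measure \<eta> {x<..} = m - cdf \<eta> x"
    proof -
      have "{x<..} = space \<eta> - {..x}" using borel_UNIV by auto
      then show ?thesis
        using finite_measure_compl[of "{..x}"] borel_UNIV assms(2) by (simp add: m_def cdf_def)
    qed
    then show "emeasure \<eta> {x<..} = emeasure (distr ?\<Omega> borel q) {x<..}"
      by (simp only: lt le emeasure_eq_measure)
    show "emeasure \<eta> {x<..} < \<infinity>"
      by (simp add: emeasure_eq_measure)
  qed (use assms in auto)
  show thesis
    by (rule that[folded m_def, OF meas mono eq])
qed

section \<open>Strassen's theorem for finitely supported measures\<close>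

text \<open>When \<open>q\<close> is a quantile function, \<open>B\<close> is a set of levels, and a
  partition of the levels splits the measure, atoms included.\<close>

definition lebesgue_image :: "(real \<Rightarrow> real) \<Rightarrow> real set \<Rightarrow> real measure" where
  "lebesgue_image q B = distr (restrict_space lborel B) borel q"

lemma sets_lebesgue_image [simp]: "sets (lebesgue_image q B) = sets borel"
  and space_lebesgue_image [simp]: "space (lebesgue_image q B) = UNIV"
  by (simp_all add: lebesgue_image_def)

lemma lebesgue_image_measurable:
  assumes "q \<in> borel_measurable borel"
  shows "q \<in> borel_measurable (restrict_space lborel B)"
  using assms by (intro measurable_restrict_space1) simp

lemma emeasure_lebesgue_image:
  assumes "q \<in> borel_measurable borel" "B \<in> sets borel" "A \<in> sets borel"
  shows "emeasure (lebesgue_image q B) A = emeasure lborel (q -` A \<inter> B)"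
proof -
  have "emeasure (lebesgue_image q B) A = emeasure (restrict_space lborel B) (q -` A \<inter> B)"
    unfolding lebesgue_image_def
    by (subst emeasure_distr[OF lebesgue_image_measurable[OF assms(1)] assms(3)])
       (simp add: space_restrict_space)
  also have "\<dots> = emeasure lborel (q -` A \<inter> B)"
    using assms(2) by (intro emeasure_restrict_space) auto
  finally show ?thesis .
qed

lemma integral_lebesgue_image:
  fixes f :: "real \<Rightarrow> real"
  assumes "q \<in> borel_measurable borel" "B \<in> sets borel" "f \<in> borel_measurable borel"
  shows "(LINT x|lebesgue_image q B. f x) = (LINT u:B|lborel. f (q u))"
  using assms lebesgue_image_measurable[OF assms(1), of B]
  by (simp add: lebesgue_image_def integral_distr integral_restrict_space set_lebesgue_integral_def)

lemma integrable_lebesgue_image: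
  fixes f :: "real \<Rightarrow> real"
  assumes "q \<in> borel_measurable borel" "B \<in> sets borel" "f \<in> borel_measurable borel"
  shows "integrable (lebesgue_image q B) f \<longleftrightarrow> set_integrable lborel B (\<lambda>u. f (q u))"
  using assms lebesgue_image_measurable[OF assms(1), of B]
  by (simp add: lebesgue_image_def integrable_distr_eq integrable_restrict_space set_integrable_def)

text \<open>The integral over a sliding window of width \<open>w\<close> is a difference of two
  values of a primitive, hence continuous in the position of the window. The intermediate value
  theorem gives the position with value \<open>c\<close>.\<close>

lemma window_with_given_integral:
  fixes q :: "real \<Rightarrow> real"
  assumes int: "set_integrable lborel {0<..<M} q" and w: "0 \<le> w" "w \<le> M"
    and lo: "(LINT u:{0<..<w}|lborel. q u) \<le> c" and hi: "c \<le> (LINT u:{M - w<..<M}|lborel. q u)"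
  obtains s where "0 \<le> s" "s + w \<le> M" "(LINT u:{s<..<s + w}|lborel. q u) = c"
proof -
  \<comment> \<open>Extension by zero, so that a primitive exists on every interval.\<close>
  define f where "f u = indicator {0<..<M} u * q u" for u
  have fint: "set_integrable lborel B f" if "B \<in> sets borel" for B
    using int that integrable_mult_indicator[of B lborel "\<lambda>u. indicator {0<..<M} u * q u"]
    unfolding f_def set_integrable_def by simp
  have fHK: "f integrable_on {a..b}" for a b
    using set_borel_integral_eq_integral(1)[OF fint] by simp
  define G where "G s = integral {0..s} f" for s
  have G: "(LINT u:{s<..<s + w}|lborel. q u) = G (s + w) - G s" if "0 \<le> s" "s + w \<le> M" for s
  proof -
    have "(LINT u:{s<..<s + w}|lborel. q u) = (LINT u:{s<..<s + w}|lborel. f u)"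
      using that by (intro set_lebesgue_integral_cong) (auto simp: f_def)
    also have "\<dots> = integral {s<..<s + w} f"
      by (intro set_borel_integral_eq_integral(2) fint) simp
    also have "\<dots> = integral {s..s + w} f"
      by (rule integral_open_interval_real[symmetric])
    also have "\<dots> = G (s + w) - G s"
      using Henstock_Kurzweil_Integration.integral_combine[of 0 s "s + w" f] that w fHK
      by (simp add: G_def)
    finally show ?thesis .
  qed
  have contG: "continuous_on {0..M} G"
    unfolding G_def by (rule indefinite_integral_continuous_1[OF fHK])
  have "continuous_on {0..M - w} (\<lambda>s. G (s + w))"
    by (rule continuous_on_compose2[OF contG]) (use w in \<open>auto intro!: continuous_intros\<close>)
  then have "continuous_on {0..M - w} (\<lambda>s. G (s + w) - G s)"
    using w by (intro continuous_on_diff continuous_on_subset[OF contG]) auto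
  moreover have "G (0 + w) - G 0 \<le> c" "c \<le> G (M - w + w) - G (M - w)"
    using lo hi G[of 0] G[of "M - w"] w by auto
  ultimately obtain s where "0 \<le> s" "s \<le> M - w" "G (s + w) - G s = c"
    using IVT'[of "\<lambda>s. G (s + w) - G s" 0 c "M - w"] w by auto
  with G[of s] that[of s] show thesis by simp
qed

lemma lebesgue_image_subset:
  assumes q: "q \<in> borel_measurable borel" "set_integrable lborel {0<..<M} q"
    and B: "B \<in> sets borel" "B \<subseteq> {0<..<M}"
  shows "lebesgue_image q B \<in> \<M>" "measure (lebesgue_image q B) UNIV = measure lborel B"
    "put_fun (lebesgue_image q B) k = (LINT u:B|lborel. max (k - q u) 0)"
    "call_fun (lebesgue_image q B) k = (LINT u:B|lborel. max (q u - k) 0)"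
    "(LINT x|lebesgue_image q B. x) = (LINT u:B|lborel. q u)"
    "set_integrable lborel B q" "set_integrable lborel B (\<lambda>u. k)"
    "set_integrable lborel B (\<lambda>u. max (k - q u) 0)"
proof -
  have e: "emeasure (lebesgue_image q B) UNIV = emeasure lborel B"
    using emeasure_lebesgue_image[OF q(1) B(1), of UNIV] by simp
  have "emeasure lborel B \<le> emeasure lborel {0<..<M}"
    using B by (intro emeasure_mono) auto
  also have "\<dots> < \<infinity>"
    by (cases "0 \<le> M") auto
  finally have fin: "emeasure lborel B < \<infinity>" .
  then have fm: "finite_measure (lebesgue_image q B)"
    using e by (intro finite_measureI) auto
  show qB: "set_integrable lborel B q"
    using set_integrable_subset[OF q(2)] B by auto
  show M: "lebesgue_image q B \<in> \<M>"
    using fm qB q B by (intro finite_first_moment_measuresI) (simp_all add: integrable_lebesgue_image)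
  note D = finite_first_moment_measuresD[OF M]
  show "measure (lebesgue_image q B) UNIV = measure lborel B"
    using e by (simp add: measure_def)
  show "put_fun (lebesgue_image q B) k = (LINT u:B|lborel. max (k - q u) 0)"
    "call_fun (lebesgue_image q B) k = (LINT u:B|lborel. max (q u - k) 0)"
    "(LINT x|lebesgue_image q B. x) = (LINT u:B|lborel. q u)"
    unfolding put_fun_def call_fun_def using q B by (simp_all add: integral_lebesgue_image)
  show "set_integrable lborel B (\<lambda>u. k)"
    by (rule integrable_lebesgue_image[OF q(1) B(1), of "\<lambda>_. k", THEN iffD1,
          OF _ finite_measure.integrable_const[OF D(3)]]) simp
  show "set_integrable lborel B (\<lambda>u. max (k - q u) 0)"
    using integrable_lebesgue_image[OF q(1) B(1), of "\<lambda>x. max (k - x) 0"] integrable_put_call[OF D(3,4)]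
    by simp
qed

text \<open>
  The first part below is the shadow of the atom \<open>w \<delta>\<^sub>m\<close> in \<open>\<xi>\<close>: the part of \<open>\<xi>\<close> between two
  quantiles that has mass \<open>w\<close> and mean \<open>m\<close>. The remaining part has no mass strictly between these
  quantiles, so its put function is affine there, which makes the chord of the convex function
  \<open>R\<close> stay below it.
\<close>

lemma shadow_of_atom:
  fixes R :: "real \<Rightarrow> real"
  assumes \<xi>: "\<xi> \<in> \<M>" and w: "0 < w" "w < M" and M_def: "M = measure \<xi> UNIV"
    and R: "convex_on UNIV R" "\<And>k. 0 \<le> R k" "\<And>k. (M - w) * k - (expv - w * m) \<le> R k"
      "\<And>k. k \<le> a0 \<Longrightarrow> R k = 0" "\<And>k. b0 \<le> k \<Longrightarrow> R k = (M - w) * k - (expv - w * m)"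
    and expv_def: "expv = (LINT x|\<xi>. x)"
    and dom: "\<And>k. R k + w * max (k - m) 0 \<le> put_fun \<xi> k"
  obtains \<xi>1 \<xi>2 where "\<xi>1 \<in> \<M>" "\<xi>2 \<in> \<M>" "measure \<xi>1 UNIV = w" "(LINT x|\<xi>1. x) = w * m"
    "measure \<xi>2 UNIV = M - w" "(LINT x|\<xi>2. x) = expv - w * m"
    "\<And>A. A \<in> sets borel \<Longrightarrow> emeasure \<xi> A = emeasure \<xi>1 A + emeasure \<xi>2 A"
    "\<And>k. R k \<le> put_fun \<xi>2 k"
proof -
  note D = finite_first_moment_measuresD[OF \<xi>]
  obtain q where q: "q \<in> borel_measurable borel" "mono_on {0<..<M} q"
    and \<xi>_eq: "\<xi> = lebesgue_image q {0<..<M}"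
    using quantile_representation[OF D(3,1)] unfolding M_def lebesgue_image_def by metis
  have mono: "q u \<le> q v" if "0 < u" "u \<le> v" "v < M" for u v
    using q(2) that by (auto simp: mono_on_def)
  have qi: "set_integrable lborel {0<..<M} q"
    using D(4) integrable_lebesgue_image[OF q(1), of "{0<..<M}" "\<lambda>x. x"] unfolding \<xi>_eq by simp
  note I = lebesgue_image_subset[OF q(1) qi]
  have P\<xi>: "put_fun \<xi> k = (LINT u:{0<..<M}|lborel. max (k - q u) 0)" for k
    unfolding \<xi>_eq by (rule I) auto
  have C\<xi>: "(LINT u:{0<..<M}|lborel. max (q u - k) 0) = put_fun \<xi> k - k * M + expv" for k
  proof -
    have "call_fun \<xi> k = (LINT u:{0<..<M}|lborel. max (q u - k) 0)"
      unfolding \<xi>_eq by (rule I) auto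
    then show ?thesis
      using put_call_parity[OF D(3,4), of k] D(2)
      by (simp add: put_fun_def call_fun_def M_def expv_def)
  qed
  have dif: "(LINT u:B|lborel. k - q u) = k * measure lborel B - (LINT u:B|lborel. q u)"
    if "B \<in> sets borel" "B \<subseteq> {0<..<M}" for B k
    using set_integral_diff(2)[OF I(7,6)[OF that], of k] that
    by (simp add: set_lebesgue_integral_def mult.commute)
  \<comment> \<open>At \<open>k = q w\<close> the put function of \<xi> is carried by the levels
    below \<open>w\<close>, so domination at this single strike bounds the mean of the leftmost
    window.\<close>
  have lo: "(LINT u:{0<..<w}|lborel. q u) \<le> w * m"
  proof -
    have "put_fun \<xi> (q w) = (LINT u:{0<..<w}|lborel. q w - q u)"
      unfolding P\<xi> set_lebesgue_integral_def
    proof (intro Bochner_Integration.integral_cong refl)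
      show "indicator {0<..<M} u *\<^sub>R max (q w - q u) 0 = indicator {0<..<w} u *\<^sub>R (q w - q u)" for u
        using mono[of u w] mono[of w u] w by (cases "u \<le> w") (auto simp: indicator_def max_def)
    qed
    also have "\<dots> = q w * w - (LINT u:{0<..<w}|lborel. q u)"
      using w by (subst dif) auto
    finally show ?thesis
      using dom[of "q w"] R(2)[of "q w"] w mult_left_mono[of "q w - m" "max (q w - m) 0" w]
      by (simp add: algebra_simps)
  qed
  \<comment> \<open>The mirror image, at the strike \<open>q (M - w)\<close> and with the call
    function. The affine lower bound on \<open>R\<close> says, by parity, that the call function
    belonging to \<open>R\<close> is nonnegative.\<close>
  have hi: "w * m \<le> (LINT u:{M - w<..<M}|lborel. q u)"
  proof -
    define k where "k = q (M - w)"
    have "(LINT u:{0<..<M}|lborel. max (q u - k) 0) = (LINT u:{M - w<..<M}|lborel. - (k - q u))"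
      unfolding set_lebesgue_integral_def
    proof (intro Bochner_Integration.integral_cong refl)
      show "indicator {0<..<M} u *\<^sub>R max (q u - k) 0 = indicator {M - w<..<M} u *\<^sub>R - (k - q u)" for u
        using mono[of u "M - w"] mono[of "M - w" u] w
        by (cases "u \<le> M - w") (auto simp: indicator_def max_def k_def)
    qed
    also have "\<dots> = - (k * w - (LINT u:{M - w<..<M}|lborel. q u))"
    proof -
      have "(LINT u:{M - w<..<M}|lborel. - (k - q u)) = - (LINT u:{M - w<..<M}|lborel. k - q u)"
        unfolding set_lebesgue_integral_def
        by (rule trans[OF Bochner_Integration.integral_cong[OF refl] Bochner_Integration.integral_minus])
           (simp add: algebra_simps)
      then show ?thesis
        using w by (subst (asm) dif) auto
    qed
    finally have "(LINT u:{0<..<M}|lborel. max (q u - k) 0) = - (k * w - (LINT u:{M - w<..<M}|lborel. q u))" .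
    moreover have "0 \<le> w * max (k - m) 0"
      using w by simp
    ultimately show ?thesis
      using dom[of k] R(3)[of k] C\<xi>[of k]
      by (simp add: algebra_simps)
  qed
  obtain s where s: "0 \<le> s" "s + w \<le> M" and sm: "(LINT u:{s<..<s + w}|lborel. q u) = w * m"
    using window_with_given_integral[OF qi _ _ lo hi] w by auto
  define J where "J = {s<..<s + w}"
  define K where "K = {0<..<M} - J"
  have J: "J \<in> sets borel" "J \<subseteq> {0<..<M}" and K: "K \<in> sets borel" "K \<subseteq> {0<..<M}"
    using s w by (auto simp: J_def K_def)
  have lJ: "measure lborel J = w"
    using w by (simp add: J_def)
  have lK: "measure lborel K = M - w"
    unfolding K_def using J w lJ by (subst measure_Diff) auto
  have split: "(LINT u:{0<..<M}|lborel. f u) = (LINT u:J|lborel. f u) + (LINT u:K|lborel. f u)"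
    if "set_integrable lborel J f" "set_integrable lborel K f" for f :: "real \<Rightarrow> real"
  proof -
    have "{0<..<M} = J \<union> K" using J by (auto simp: K_def)
    then show ?thesis
      using set_integral_Un[OF _ that] by (auto simp: K_def)
  qed
  have mK: "(LINT u:K|lborel. q u) = expv - w * m"
    using split[OF I(6)[OF J] I(6)[OF K]] sm I(5)[of "{0<..<M}"]
    unfolding expv_def J_def by (simp add: \<xi>_eq[symmetric])
  define PJ where "PJ k = (LINT u:J|lborel. max (k - q u) 0)" for k
  define PK where "PK k = (LINT u:K|lborel. max (k - q u) 0)" for k
  have P_split: "put_fun \<xi> k = PJ k + PK k" for k
    unfolding P\<xi> PJ_def PK_def by (rule split[OF I(8)[OF J] I(8)[OF K]])
  have PJ_le: "PJ k = 0" if "\<And>u. u \<in> J \<Longrightarrow> k \<le> q u" for k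
    unfolding PJ_def set_lebesgue_integral_def
    by (rule integral_eq_zero_AE) (use that in \<open>auto simp: indicator_def\<close>)
  have PJ_ge: "PJ k = w * (k - m)" if "\<And>u. u \<in> J \<Longrightarrow> q u \<le> k" for k
  proof -
    have "PJ k = (LINT u:J|lborel. k - q u)"
      unfolding PJ_def using J that by (intro set_lebesgue_integral_cong) auto
    also have "\<dots> = w * (k - m)"
      using dif[OF J, of k] lJ sm by (simp add: J_def algebra_simps)
    finally show ?thesis .
  qed
  \<comment> \<open>By Jensen \<open>PJ\<close> is never below the put function of the atom. The
    condition thus means equality, and it holds when \<open>k\<close> is not strictly inside the
    range of quantiles of the window.\<close>
  have outside: "R k \<le> PK k" if "PJ k \<le> w * max (k - m) 0" for k
    using dom[of k] P_split[of k] that by simp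
  \<comment> \<open>The affine function that \<open>PK\<close> equals between the end quantiles of
    the window; its slope \<open>s\<close> is the mass of the levels below the window. Everywhere
    else it lies below \<open>PK\<close>.\<close>
  define L where "L k = s * k - (LINT u:{0<..<M} \<inter> {..s}|lborel. q u)" for k
  have Ls: "{0<..<M} \<inter> {..s} \<in> sets borel" "{0<..<M} \<inter> {..s} \<subseteq> {0<..<M}"
    "measure lborel ({0<..<M} \<inter> {..s}) = s"
  proof -
    have "{0<..<M} \<inter> {..s} = {0<..s}" using s w by auto
    with s show "measure lborel ({0<..<M} \<inter> {..s}) = s" by simp
  qed auto
  have L_int: "L k = (LINT u:{0<..<M} \<inter> {..s}|lborel. k - q u)" for k
    unfolding L_def using dif[OF Ls(1,2), of k] Ls(3) by (simp add: mult.commute)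
  have LPK: "L k \<le> PK k" for k
    unfolding L_int PK_def set_lebesgue_integral_def
  proof (rule integral_mono)
    show "integrable lborel (\<lambda>u. indicator ({0<..<M} \<inter> {..s}) u *\<^sub>R (k - q u))"
      "integrable lborel (\<lambda>u. indicator K u *\<^sub>R max (k - q u) 0)"
      using set_integral_diff(1)[OF I(7,6)[OF Ls(1,2)]] I(8)[OF K]
      unfolding set_integrable_def by auto
  qed (auto simp: indicator_def K_def J_def)
  have PK_eq_L: "PK k = L k"
    if "\<And>u. 0 < u \<Longrightarrow> u \<le> s \<Longrightarrow> u < M \<Longrightarrow> q u \<le> k" "\<And>u. s + w \<le> u \<Longrightarrow> u < M \<Longrightarrow> k \<le> q u" for k
    unfolding L_int PK_def set_lebesgue_integral_def
  proof (intro Bochner_Integration.integral_cong refl)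
    show "indicator K u *\<^sub>R max (k - q u) 0 = indicator ({0<..<M} \<inter> {..s}) u *\<^sub>R (k - q u)" for u
      using that(1)[of u] that(2)[of u] w
      by (cases "u \<le> s"; cases "s + w \<le> u") (auto simp: indicator_def max_def K_def J_def)
  qed
  have R_le: "R k \<le> PK k" for k
  proof (cases "(\<forall>u\<in>J. k \<le> q u) \<or> (\<forall>u\<in>J. q u \<le> k)")
    case True
    then have "PJ k \<le> w * max (k - m) 0"
      using PJ_le[of k] PJ_ge[of k] w mult_left_mono[of "k - m" "max (k - m) 0" w] by auto
    then show ?thesis by (rule outside)
  next
    case False
    then obtain u1 u2 where u: "u1 \<in> J" "q u1 < k" "u2 \<in> J" "k < q u2"
      by (auto simp: not_le)
    \<comment> \<open>The natural left end of the chord is the quantile \<open>q s\<close>. If the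
      window starts at level 0 there is no such quantile, but then \<open>L\<close> vanishes, and so
      does \<open>R\<close> to the left of \<open>a0\<close>.\<close>
    have "\<exists>a\<le>k. R a \<le> L a"
    proof (cases "s = 0")
      case True
      then have "L a = 0" for a
        using s by (simp add: L_def set_lebesgue_integral_def)
      moreover have "R (min k a0) = 0" by (rule R(4)) simp
      ultimately show ?thesis by (intro exI[of _ "min k a0"]) simp
    next
      case False
      have 1: "q s \<le> q u" if "s \<le> u" "u < M" for u
        using mono[of s u] that s False by simp
      have "PJ (q s) = 0"
        using s w by (intro PJ_le 1) (auto simp: J_def)
      moreover have "0 \<le> w * max (q s - m) 0" using w by simp
      ultimately have "R (q s) \<le> PK (q s)" using outside[of "q s"] by simp
      also have "\<dots> = L (q s)"
        using s w False by (intro PK_eq_L 1 mono) auto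
      finally have "R (q s) \<le> L (q s)" .
      moreover have "q s \<le> k"
        using 1[of u1] u J by (force simp: J_def)
      ultimately show ?thesis by auto
    qed
    then obtain a where a: "a \<le> k" "R a \<le> L a" by auto
    \<comment> \<open>Likewise on the right with \<open>q (s + w)\<close>. If the window ends at
      level \<open>M\<close>, then \<open>L\<close> is the affine function that \<open>R\<close>
      equals to the right of \<open>b0\<close>.\<close>
    have "\<exists>b\<ge>k. R b \<le> L b"
    proof (cases "s + w = M")
      case True
      then have "K = {0<..<M} \<inter> {..s}" by (auto simp: K_def J_def)
      then have "L b = (M - w) * b - (expv - w * m)" for b
        using mK True by (auto simp: L_def algebra_simps)
      moreover have "R (max k b0) = (M - w) * max k b0 - (expv - w * m)" by (rule R(5)) simp
      ultimately show ?thesis by (intro exI[of _ "max k b0"]) simp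
    next
      case False
      define b where "b = q (s + w)"
      have 1: "q u \<le> b" if "0 < u" "u \<le> s + w" for u
        using mono[of u "s + w"] that s False by (simp add: b_def)
      have "PJ b = w * (b - m)"
        using s w by (intro PJ_ge 1) (auto simp: J_def)
      moreover have "w * (b - m) \<le> w * max (b - m) 0" using w by simp
      ultimately have "R b \<le> PK b" using outside[of b] by simp
      also have "\<dots> = L b"
        unfolding b_def using s w False by (intro PK_eq_L 1[unfolded b_def] mono) auto
      finally have "R b \<le> L b" .
      moreover have "k \<le> b"
        using 1[of u2] u s by (force simp: J_def)
      ultimately show ?thesis by auto
    qed
    then obtain b where b: "k \<le> b" "R b \<le> L b" by auto
    have "R k \<le> L k"
    proof (cases "a = b")
      case True
      then show ?thesis using a b by (metis antisym)
    next
      case False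
      define t where "t = (k - a) / (b - a)"
      have t: "0 \<le> t" "t \<le> 1" "k = (1 - t) * a + t * b"
        using False a b by (auto simp: t_def divide_simps) (auto simp: algebra_simps)
      then have "R k \<le> (1 - t) * R a + t * R b"
        using convex_onD[OF R(1), of t a b] by simp
      also have "\<dots> \<le> (1 - t) * L a + t * L b"
        using t a b by (intro add_mono mult_left_mono) auto
      also have "\<dots> = L k"
        unfolding L_def t(3) by (simp add: algebra_simps)
      finally show ?thesis .
    qed
    with LPK[of k] show ?thesis by simp
  qed
  show thesis
  proof (rule that[of "lebesgue_image q J" "lebesgue_image q K"])
    fix A :: "real set" assume A: "A \<in> sets borel"
    have "q -` A \<inter> {0<..<M} = (q -` A \<inter> J) \<union> (q -` A \<inter> K)" "(q -` A \<inter> J) \<inter> (q -` A \<inter> K) = {}"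
      using J by (auto simp: K_def)
    moreover have "q -` A \<in> sets borel"
      using measurable_sets[OF q(1) A] by simp
    ultimately show "emeasure \<xi> A = emeasure (lebesgue_image q J) A + emeasure (lebesgue_image q K) A"
      unfolding \<xi>_eq using A J K q by (simp add: emeasure_lebesgue_image plus_emeasure)
  next
    show "R k \<le> put_fun (lebesgue_image q K) k" for k
      using R_le[of k] I(3)[OF K] by (simp add: PK_def)
  qed (use I[OF J] I[OF K] lJ lK mK sm in \<open>simp_all add: J_def\<close>)
qed

lemma max_0_convex_comb:
  fixes a b t :: real
  assumes "0 \<le> t" "t \<le> 1"
  shows "max ((1 - t) * a + t * b) 0 \<le> (1 - t) * max a 0 + t * max b 0"
proof -
  have "(1 - t) * a \<le> (1 - t) * max a 0" "t * b \<le> t * max b 0"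
    using assms by (auto intro!: mult_left_mono)
  moreover have "0 \<le> (1 - t) * max a 0" "0 \<le> t * max b 0"
    using assms by auto
  ultimately show ?thesis by (intro max.boundedI) simp_all
qed

lemma convex_on_sum_call_payoffs:
  fixes w m :: "'i \<Rightarrow> real"
  assumes "\<And>i. i \<in> F \<Longrightarrow> 0 \<le> w i"
  shows "convex_on UNIV (\<lambda>k. \<Sum>i\<in>F. w i * max (k - m i) 0)"
proof (rule convex_onI)
  fix t x y :: real assume t: "0 < t" "t < 1"
  have "(1 - t) * x + t * y - a = (1 - t) * (x - a) + t * (y - a)" for a
    by (simp add: algebra_simps)
  then have "max ((1 - t) * x + t * y - a) 0 \<le> (1 - t) * max (x - a) 0 + t * max (y - a) 0" for a
    using max_0_convex_comb[of t "x - a" "y - a"] t by simp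
  then have "(\<Sum>i\<in>F. w i * max ((1 - t) * x + t * y - m i) 0)
      \<le> (\<Sum>i\<in>F. w i * ((1 - t) * max (x - m i) 0 + t * max (y - m i) 0))"
    using assms by (intro sum_mono mult_left_mono)
  also have "\<dots> = (1 - t) * (\<Sum>i\<in>F. w i * max (x - m i) 0) + t * (\<Sum>i\<in>F. w i * max (y - m i) 0)"
    by (simp add: sum_distrib_left distrib_left sum.distrib mult.left_commute)
  finally show "(\<Sum>i\<in>F. w i * max ((1 - t) *\<^sub>R x + t *\<^sub>R y - m i) 0)
      \<le> (1 - t) * (\<Sum>i\<in>F. w i * max (x - m i) 0) + t * (\<Sum>i\<in>F. w i * max (y - m i) 0)"
    by simp
qed simp

text \<open>The shadow of one atom is removed from \<xi>, and the last conclusion of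
  \<open>shadow_of_atom\<close> is the domination hypothesis for the remaining atoms and the
  remaining measure. The measures \<open>X i\<close> are the targets of the single atoms;
  prescribing their means is the martingale condition.\<close>

lemma strassen_finite:
  fixes w m :: "'i \<Rightarrow> real"
  assumes "finite I" "\<And>i. i \<in> I \<Longrightarrow> 0 < w i" "\<xi> \<in> \<M>" "measure \<xi> UNIV = (\<Sum>i\<in>I. w i)"
    "(LINT x|\<xi>. x) = (\<Sum>i\<in>I. w i * m i)"
    "\<And>k. (\<Sum>i\<in>I. w i * max (k - m i) 0) \<le> put_fun \<xi> k"
  shows "\<exists>X. (\<forall>i\<in>I. X i \<in> \<M> \<and> measure (X i) UNIV = w i \<and> (LINT x|X i. x) = w i * m i) \<and>
    (\<forall>A\<in>sets borel. emeasure \<xi> A = (\<Sum>i\<in>I. emeasure (X i) A))"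
  using assms
proof (induction I arbitrary: \<xi> rule: finite_induct)
  case empty
  note D = finite_first_moment_measuresD[OF \<open>\<xi> \<in> \<M>\<close>]
  have "emeasure \<xi> A = 0" for A
  proof -
    have "emeasure \<xi> A \<le> emeasure \<xi> UNIV" using D by (metis emeasure_space)
    also have "\<dots> = 0" using empty finite_measure.emeasure_eq_measure[OF D(3)] by simp
    finally show ?thesis by simp
  qed
  then show ?case by auto
next
  case (insert j F)
  show ?case
  \<comment> \<open>The shadow of an atom requires positive mass to remain; the last atom simply
    takes all that is left.\<close>
  proof (cases "F = {}")
    case True
    with insert.prems show ?thesis by (intro exI[of _ "\<lambda>_. \<xi>"]) auto
  next
    case False
    let ?M = "measure \<xi> UNIV" and ?e = "LINT x|\<xi>. x"
    define R where "R k = (\<Sum>i\<in>F. w i * max (k - m i) 0)" for k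
    have pos: "0 < w j" "\<And>i. i \<in> F \<Longrightarrow> 0 < w i"
      using insert.prems(1) by auto
    have M: "?M = w j + (\<Sum>i\<in>F. w i)" and e: "?e = w j * m j + (\<Sum>i\<in>F. w i * m i)"
      using insert by auto
    have "0 < (\<Sum>i\<in>F. w i)"
      using insert.hyps False pos by (intro sum_pos) auto
    then have less: "w j < ?M" using M by simp
    have affine: "(?M - w j) * k - (?e - w j * m j) = (\<Sum>i\<in>F. w i * (k - m i))" for k
      unfolding M e by (simp add: algebra_simps sum_distrib_left sum_subtractf)
    obtain \<xi>1 \<xi>2 where \<xi>: "\<xi>1 \<in> \<M>" "\<xi>2 \<in> \<M>" "measure \<xi>1 UNIV = w j" "(LINT x|\<xi>1. x) = w j * m j"
      "measure \<xi>2 UNIV = ?M - w j" "(LINT x|\<xi>2. x) = ?e - w j * m j"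
      "\<And>A. A \<in> sets borel \<Longrightarrow> emeasure \<xi> A = emeasure \<xi>1 A + emeasure \<xi>2 A"
      "\<And>k. R k \<le> put_fun \<xi>2 k"
    proof (rule shadow_of_atom[OF insert.prems(2) pos(1) less refl _ _ _ _ _ refl])
      show "convex_on UNIV R"
        unfolding R_def using pos by (intro convex_on_sum_call_payoffs) (auto intro: less_imp_le)
      show "0 \<le> R k" for k
        unfolding R_def using pos by (intro sum_nonneg mult_nonneg_nonneg) (auto intro: less_imp_le)
      show "(?M - w j) * k - (?e - w j * m j) \<le> R k" for k
        unfolding R_def affine using pos by (intro sum_mono mult_left_mono) (auto intro: less_imp_le)
      show "R k = 0" if "k \<le> Min (m ` F)" for k
      proof -
        have "k \<le> m i" if "i \<in> F" for i
          using \<open>k \<le> Min (m ` F)\<close> insert.hyps that by (meson Min_le finite_imageI image_eqI order_trans)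
        then show ?thesis
          unfolding R_def by (intro sum.neutral) (auto simp: max_def)
      qed
      show "R k = (?M - w j) * k - (?e - w j * m j)" if "Max (m ` F) \<le> k" for k
      proof -
        have "m i \<le> k" if "i \<in> F" for i
          using \<open>Max (m ` F) \<le> k\<close> insert.hyps that by (meson Max_ge finite_imageI image_eqI order_trans)
        then show ?thesis
          unfolding R_def affine by (intro sum.cong) (auto simp: max_absorb1)
      qed
      show "R k + w j * max (k - m j) 0 \<le> put_fun \<xi> k" for k
        using insert.prems(5)[of k] insert.hyps by (simp add: R_def algebra_simps)
    qed blast
    have "\<exists>X. (\<forall>i\<in>F. X i \<in> \<M> \<and> measure (X i) UNIV = w i \<and> (LINT x|X i. x) = w i * m i) \<and>
      (\<forall>A\<in>sets borel. emeasure \<xi>2 A = (\<Sum>i\<in>F. emeasure (X i) A))"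
      using \<xi> M e pos by (intro insert.IH) (auto simp: R_def)
    then obtain X where X: "\<And>i. i \<in> F \<Longrightarrow> X i \<in> \<M> \<and> measure (X i) UNIV = w i \<and> (LINT x|X i. x) = w i * m i"
      "\<And>A. A \<in> sets borel \<Longrightarrow> emeasure \<xi>2 A = (\<Sum>i\<in>F. emeasure (X i) A)"
      by auto
    have "(\<Sum>i\<in>F. emeasure ((X(j := \<xi>1)) i) A) = (\<Sum>i\<in>F. emeasure (X i) A)" for A
      using insert.hyps by (intro sum.cong) auto
    then show ?thesis
      using X \<xi> insert.hyps by (intro exI[of _ "X(j := \<xi>1)"]) auto
  qed
qed

section \<open>Upper bound for the weak transport cost\<close>

text \<open>The convex order between the image of \<eta> and \<xi>, in its one-parameter form: equal
  mass, equal mean and ordered put functions.\<close>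

definition dominated_map :: "real measure \<Rightarrow> real measure \<Rightarrow> (real \<Rightarrow> real) \<Rightarrow> bool" where
  "dominated_map \<eta> \<xi> S \<longleftrightarrow> S \<in> borel_measurable borel \<and> integrable \<eta> S \<and>
     measure \<eta> UNIV = measure \<xi> UNIV \<and> (LINT x|\<eta>. S x) = (LINT x|\<xi>. x) \<and>
     (\<forall>k. (LINT x|\<eta>. max (k - S x) 0) \<le> put_fun \<xi> k)"

text \<open>The coupling is \<eta> composed, by the monadic bind, with the kernel that sends x to
  the law of (x, y) for y distributed as \<open>\<kappa> x\<close>. Only the kernel consists of
  probability measures; \<eta> may have any mass.\<close>

lemma exists_coupling_of_kernel:
  fixes \<eta> \<xi> :: "real measure" and \<kappa> :: "real \<Rightarrow> real measure"
  assumes \<eta>: "sets \<eta> = sets borel" and \<xi>: "sets \<xi> = sets borel"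
    and \<kappa>: "\<kappa> \<in> borel \<rightarrow>\<^sub>M prob_algebra borel"
    and marg: "\<And>B. B \<in> sets borel \<Longrightarrow> (\<integral>\<^sup>+ x. emeasure (\<kappa> x) B \<partial>\<eta>) = emeasure \<xi> B"
  obtains \<pi> where "\<pi> \<in> couplings \<eta> \<xi>" "disintegration \<pi> \<eta> \<kappa>"
proof -
  have sp: "space \<eta> = UNIV" using sets_eq_imp_space_eq[OF \<eta>] by simp
  have K: "prob_space (\<kappa> x)" "sets (\<kappa> x) = sets borel" for x
    using measurable_space[OF \<kappa>, of x] by (auto simp: space_prob_algebra)
  have spK: "space (\<kappa> x) = UNIV" for x
    using sets_eq_imp_space_eq[OF K(2)[of x]] by simp
  have [measurable]: "\<kappa> \<in> \<eta> \<rightarrow>\<^sub>M subprob_algebra borel"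
    using measurable_prob_algebraD[OF \<kappa>] measurable_cong_sets[OF \<eta> refl] by blast
  note [measurable_cong] = \<eta>
  define \<kappa>2 where "\<kappa>2 x = \<kappa> x \<bind> (\<lambda>y. return (borel :: (real \<times> real) measure) (x, y))" for x
  have ret: "(\<lambda>y. return (borel :: (real \<times> real) measure) (x, y)) \<in> borel \<rightarrow>\<^sub>M subprob_algebra borel" for x :: real
    by (rule measurable_compose[OF _ return_measurable]) (simp add: borel_prod[symmetric])
  have [measurable]: "\<kappa>2 \<in> \<eta> \<rightarrow>\<^sub>M subprob_algebra (borel :: (real \<times> real) measure)"
    unfolding \<kappa>2_def
  proof (rule measurable_bind)
    show "(\<lambda>x. return (borel :: (real \<times> real) measure) (fst x, snd x)) \<in> \<eta> \<Otimes>\<^sub>M borel \<rightarrow>\<^sub>M subprob_algebra borel"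
      by (rule measurable_compose[OF _ return_measurable])
         (simp add: borel_prod[symmetric] measurable_ident_sets sets_pair_measure_cong[OF \<eta> refl])
  qed measurable
  have slice: "{y. (x, y) \<in> A} \<in> sets borel" if "A \<in> sets (borel :: (real \<times> real) measure)" for A and x :: real
  proof -
    have "(\<lambda>y. (x, y)) \<in> borel \<rightarrow>\<^sub>M (borel :: (real \<times> real) measure)"
      by (simp add: borel_prod[symmetric])
    from measurable_sets[OF this that] show ?thesis by (simp add: vimage_def)
  qed
  have e2: "emeasure (\<kappa>2 x) A = emeasure (\<kappa> x) {y. (x, y) \<in> A}"
    if A: "A \<in> sets (borel :: (real \<times> real) measure)" for A x
  proof -
    have "emeasure (\<kappa>2 x) A = (\<integral>\<^sup>+ y. emeasure (return borel (x, y)) A \<partial>\<kappa> x)"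
      unfolding \<kappa>2_def
    proof (rule emeasure_bind)
      show "(\<lambda>y. return borel (x, y)) \<in> \<kappa> x \<rightarrow>\<^sub>M subprob_algebra borel"
        using ret[of x] measurable_cong_sets[OF K(2) refl] by blast
    qed (use A spK in auto)
    also have "\<dots> = (\<integral>\<^sup>+ y. indicator {y. (x, y) \<in> A} y \<partial>\<kappa> x)"
      using A by (intro nn_integral_cong) (auto simp: indicator_def)
    also have "\<dots> = emeasure (\<kappa> x) {y. (x, y) \<in> A}"
      using slice[OF A, of x] K(2) by (intro nn_integral_indicator) simp
    finally show ?thesis .
  qed
  define \<pi> where "\<pi> = \<eta> \<bind> \<kappa>2"
  have sets_\<kappa>2: "sets (\<kappa>2 x) = sets borel" for x
    unfolding \<kappa>2_def using spK by (subst sets_bind) auto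
  have sets\<pi>: "sets \<pi> = sets borel"
    unfolding \<pi>_def using sp sets_\<kappa>2 by (subst sets_bind) auto
  have e\<pi>: "emeasure \<pi> A = (\<integral>\<^sup>+ x. emeasure (\<kappa> x) {y. (x, y) \<in> A} \<partial>\<eta>)"
    if "A \<in> sets borel" for A
    unfolding \<pi>_def using that sp by (subst emeasure_bind) (auto simp: e2)
  have sp\<pi>: "space \<pi> = UNIV" using sets_eq_imp_space_eq[OF sets\<pi>] by simp
  have fst_m: "fst \<in> \<pi> \<rightarrow>\<^sub>M (borel :: real measure)" and snd_m: "snd \<in> \<pi> \<rightarrow>\<^sub>M (borel :: real measure)"
    unfolding measurable_cong_sets[OF sets\<pi> refl]
    by (auto intro!: borel_measurable_continuous_onI continuous_intros)
  have "distr \<pi> borel fst = \<eta>"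
  proof (rule measure_eqI)
    fix B assume "B \<in> sets (distr \<pi> borel fst)"
    then have B: "B \<in> sets borel" by simp
    have "emeasure (distr \<pi> borel fst) B = emeasure \<pi> (fst -` B)"
      using fst_m B sp\<pi> by (simp add: emeasure_distr)
    also have "\<dots> = (\<integral>\<^sup>+ x. emeasure (\<kappa> x) {y. x \<in> B} \<partial>\<eta>)"
      using measurable_sets[OF fst_m B] sets\<pi> sp\<pi> by (subst e\<pi>) auto
    also have "\<dots> = (\<integral>\<^sup>+ x. indicator B x \<partial>\<eta>)"
      using prob_space.emeasure_space_1[OF K(1)] spK
      by (intro nn_integral_cong) (auto simp: indicator_def)
    finally show "emeasure (distr \<pi> borel fst) B = emeasure \<eta> B"
      using B \<eta> by simp
  qed (use \<eta> in simp)
  moreover have "distr \<pi> borel snd = \<xi>"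
  proof (rule measure_eqI)
    fix B assume "B \<in> sets (distr \<pi> borel snd)"
    then have B: "B \<in> sets borel" by simp
    have "emeasure (distr \<pi> borel snd) B = emeasure \<pi> (snd -` B)"
      using snd_m B sp\<pi> by (simp add: emeasure_distr)
    also have "\<dots> = (\<integral>\<^sup>+ x. emeasure (\<kappa> x) B \<partial>\<eta>)"
      using measurable_sets[OF snd_m B] sets\<pi> sp\<pi> by (subst e\<pi>) auto
    finally show "emeasure (distr \<pi> borel snd) B = emeasure \<xi> B"
      using marg[OF B] by simp
  qed (use \<xi> in simp)
  ultimately have "\<pi> \<in> couplings \<eta> \<xi>"
    using sets\<pi> by (simp add: couplings_def)
  moreover have "disintegration \<pi> \<eta> \<kappa>"
    using \<kappa> e\<pi> by (simp add: disintegration_def)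
  ultimately show thesis by (rule that)
qed

text \<open>Null fibres are left out because averages over a fibre divide by its mass, and
  \<open>strassen_finite\<close> asks for positive weights.\<close>

lemma integral_eq_sum_fibres:
  fixes f :: "real \<Rightarrow> real" and s :: "real \<Rightarrow> real"
  assumes "finite_measure \<eta>" "space \<eta> = UNIV" "simple_function \<eta> s" "integrable \<eta> f"
  shows "(LINT x|\<eta>. f x) =
    (\<Sum>v\<in>{v \<in> range s. 0 < measure \<eta> (s -` {v})}. LINT x|\<eta>. indicator (s -` {v}) x * f x)"
proof -
  interpret finite_measure \<eta> by fact
  have fin: "finite (range s)"
    using simple_functionD(1)[OF assms(3)] assms(2) by simp
  have ms: "s -` {v} \<in> sets \<eta>" for v
    using simple_functionD(2)[OF assms(3), of "{v}"] assms(2) by simp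
  have int: "integrable \<eta> (\<lambda>x. indicator (s -` {v}) x * f x)" for v
    using integrable_mult_indicator[OF ms assms(4)] by simp
  have "f x = (\<Sum>v\<in>range s. indicator (s -` {v}) x * f x)" for x
  proof -
    have "(\<Sum>v\<in>range s. indicator (s -` {v}) x * f x) = (\<Sum>v\<in>range s. if v = s x then f x else 0)"
      by (intro sum.cong) (auto simp: indicator_def)
    then show ?thesis using fin by simp
  qed
  then have "(LINT x|\<eta>. f x) = (LINT x|\<eta>. (\<Sum>v\<in>range s. indicator (s -` {v}) x * f x))"
    by (intro Bochner_Integration.integral_cong) auto
  also have "\<dots> = (\<Sum>v\<in>range s. LINT x|\<eta>. indicator (s -` {v}) x * f x)"
    using int by (rule Bochner_Integration.integral_sum)
  also have "\<dots> = (\<Sum>v\<in>{v \<in> range s. 0 < measure \<eta> (s -` {v})}. LINT x|\<eta>. indicator (s -` {v}) x * f x)"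
  proof (rule sum.mono_neutral_right[OF fin]; safe)
    fix x assume "(LINT y|\<eta>. indicator (s -` {s x}) y * f y) \<noteq> 0"
    moreover have "(LINT y|\<eta>. indicator (s -` {s x}) y * f y) = 0" if "measure \<eta> (s -` {s x}) = 0"
    proof (rule integral_eq_zero_AE)
      have "s -` {s x} \<in> null_sets \<eta>"
        using that ms by (intro null_setsI) (simp_all add: emeasure_eq_measure)
      then show "AE y in \<eta>. indicator (s -` {s x}) y * f y = 0"
        by (rule AE_mp[OF AE_not_in]) (auto simp: indicator_def)
    qed
    ultimately show "0 < measure \<eta> (s -` {s x})"
      by (metis measure_nonneg less_eq_real_def)
  qed auto
  finally show ?thesis .
qed

text \<open>
  Averaging \<open>S\<close> over the fibres of a simple function \<open>s\<close> yields a finitely supported measure that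
  is still dominated by \<open>\<xi>\<close> (Jensen). Sending each fibre to \<open>\<xi>\<close> by the kernel of
  \<open>strassen_finite\<close>, the barycentre differs from \<open>S\<close> by at most \<open>2 \<parallel>S - s\<parallel>\<close> in \<open>L\<^sup>1\<close>.
\<close>

lemma weak_transport_cost_le_simple:
  fixes h s :: "real \<Rightarrow> real"
  assumes \<eta>: "\<eta> \<in> \<M>" and \<xi>: "\<xi> \<in> \<M>" and S: "dominated_map \<eta> \<xi> S" and s: "simple_function \<eta> s"
    and h: "h \<in> borel_measurable borel" "\<And>x. 0 \<le> h x" "\<And>x y. \<bar>h x - h y\<bar> \<le> \<bar>x - y\<bar>"
  shows "weak_transport_cost h \<eta> \<xi> \<le>
    ennreal ((LINT x|\<eta>. h (x - S x)) + 2 * (LINT x|\<eta>. \<bar>S x - s x\<bar>))"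
proof -
  note D = finite_first_moment_measuresD[OF \<eta>]
  note E = finite_first_moment_measuresD[OF \<xi>]
  interpret finite_measure \<eta> by (rule D)
  note [measurable_cong] = D(1)
  have Sm[measurable]: "S \<in> borel_measurable borel" and Si: "integrable \<eta> S"
    using S by (auto simp: dominated_map_def)
  note [measurable] = h(1)
  have sm: "s \<in> borel \<rightarrow>\<^sub>M count_space UNIV"
    using measurable_simple_function[OF s] measurable_cong_sets[OF D(1) refl] by blast
  have fin: "finite (range s)"
    using simple_functionD(1)[OF s] D(2) by simp
  have ms: "s -` {v} \<in> sets \<eta>" for v
    using simple_functionD(2)[OF s, of "{v}"] D(2) by simp
  have gm[measurable]: "(\<lambda>x. g (s x)) \<in> borel_measurable borel" for g :: "real \<Rightarrow> real"
    using measurable_compose[OF sm, of g borel] by simp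
  have sb[measurable]: "s \<in> borel_measurable borel"
    using gm[of "\<lambda>v. v"] by simp
  have gi: "integrable \<eta> (\<lambda>x. g (s x))" for g :: "real \<Rightarrow> real"
  proof (rule integrable_const_bound[of _ "Max (range (\<lambda>x. \<bar>g (s x)\<bar>))"])
    have "finite (range (\<lambda>x. \<bar>g (s x)\<bar>))"
      using finite_imageI[OF fin, of "\<lambda>v. \<bar>g v\<bar>"] by (simp add: image_image)
    then show "AE x in \<eta>. norm (g (s x)) \<le> Max (range (\<lambda>x. \<bar>g (s x)\<bar>))"
      by (intro AE_I2) (auto intro: Max_ge)
  qed measurable
  have si: "integrable \<eta> s" using gi[of "\<lambda>v. v"] by simp
  define I where "I = {v \<in> range s. 0 < measure \<eta> (s -` {v})}"
  define N where "N v f = (LINT x|\<eta>. indicator (s -` {v}) x * f x)" for v and f :: "real \<Rightarrow> real"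
  have sum_N: "(LINT x|\<eta>. f x) = (\<Sum>v\<in>I. N v f)" if "integrable \<eta> f" for f
    unfolding I_def N_def by (rule integral_eq_sum_fibres[OF D(3,2) s that])
  have int: "integrable \<eta> (\<lambda>x. indicator (s -` {v}) x * f x)" if "integrable \<eta> f" for v and f :: "real \<Rightarrow> real"
    using integrable_mult_indicator[OF ms that] by simp
  have N_mono: "N v f \<le> N v g" if "integrable \<eta> f" "integrable \<eta> g" "\<And>x. s x = v \<Longrightarrow> f x \<le> g x" for v f g
    unfolding N_def using that(3)
    by (intro integral_mono int that(1,2)) (auto simp: indicator_def)
  have N_diff: "N v (\<lambda>x. f x - g x) = N v f - N v g" if "integrable \<eta> f" "integrable \<eta> g" for v f g
    unfolding N_def right_diff_distrib
    by (rule Bochner_Integration.integral_diff) (auto intro: int that)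
  define w where "w v = measure \<eta> (s -` {v})" for v
  define m where "m v = N v S / w v" for v
  have wpos: "0 < w v" if "v \<in> I" for v
    using that by (auto simp: I_def w_def)
  have N_const: "N v (\<lambda>_. c) = c * w v" for v c
  proof -
    have "N v (\<lambda>_. c) = (LINT x|\<eta>. indicator (s -` {v}) x) * c"
      unfolding N_def by simp
    then show ?thesis using D(2) by (simp add: w_def)
  qed
  have wm: "w v * m v = N v S" if "v \<in> I" for v
    using wpos[OF that] by (simp add: m_def)
  have "\<exists>X. (\<forall>v\<in>I. X v \<in> \<M> \<and> measure (X v) UNIV = w v \<and> (LINT x|X v. x) = w v * m v) \<and>
      (\<forall>A\<in>sets borel. emeasure \<xi> A = (\<Sum>v\<in>I. emeasure (X v) A))"
  proof (rule strassen_finite[OF _ wpos \<xi>])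
    show "finite I" using fin by (auto simp: I_def)
    show "measure \<xi> UNIV = sum w I"
      using S sum_N[of "\<lambda>_. 1"] N_const[of _ 1] D(2) by (simp add: dominated_map_def)
    show "(LINT x|\<xi>. x) = (\<Sum>v\<in>I. w v * m v)"
      using S sum_N[OF Si] wm by (simp add: dominated_map_def)
    fix k
    have "w v * max (k - m v) 0 \<le> N v (\<lambda>x. max (k - S x) 0)" if "v \<in> I" for v
    proof -
      note i = integrable_put_call(1)[OF D(3) Si, of k]
      have "w v * (k - m v) = N v (\<lambda>x. k - S x)"
        using Si wm[OF that] N_const[of v k] by (subst N_diff) (auto simp: algebra_simps)
      also have "\<dots> \<le> N v (\<lambda>x. max (k - S x) 0)"
        using Si i by (intro N_mono) auto
      finally have "w v * (k - m v) \<le> N v (\<lambda>x. max (k - S x) 0)" .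
      moreover have "0 \<le> N v (\<lambda>x. max (k - S x) 0)"
        using N_mono[OF _ i, of "\<lambda>_. 0" v] N_const[of v 0] by simp
      ultimately show ?thesis by (auto simp: max_def)
    qed
    then have "(\<Sum>v\<in>I. w v * max (k - m v) 0) \<le> (LINT x|\<eta>. max (k - S x) 0)"
      using sum_N[OF integrable_put_call(1)[OF D(3) Si, of k]] by (simp add: sum_mono)
    also have "\<dots> \<le> put_fun \<xi> k"
      using S by (simp add: dominated_map_def)
    finally show "(\<Sum>v\<in>I. w v * max (k - m v) 0) \<le> put_fun \<xi> k" .
  qed
  then obtain X where X: "\<And>v. v \<in> I \<Longrightarrow> X v \<in> \<M>" "\<And>v. v \<in> I \<Longrightarrow> measure (X v) UNIV = w v"
      "\<And>v. v \<in> I \<Longrightarrow> (LINT x|X v. x) = w v * m v"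
      "\<And>A. A \<in> sets borel \<Longrightarrow> emeasure \<xi> A = (\<Sum>v\<in>I. emeasure (X v) A)"
    by auto
  \<comment> \<open>The pieces of \<xi> normalised to probability measures. On null fibres an
    arbitrary probability measure is inserted, so that every value is one.\<close>
  define K where "K v = (if v \<in> I then density (X v) (\<lambda>_. ennreal (1 / w v)) else return borel 0)" for v
  have K_sets: "sets (K v) = sets borel" for v
    using finite_first_moment_measuresD(1)[OF X(1)] by (simp add: K_def)
  have K_e: "emeasure (K v) A = ennreal (1 / w v) * emeasure (X v) A" if "v \<in> I" "A \<in> sets borel" for v A
    using that finite_first_moment_measuresD(1)[OF X(1)[OF that(1)]]
    by (simp add: K_def emeasure_density_const)
  have K_prob: "prob_space (K v)" for v
  proof (cases "v \<in> I")
    case True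
    note F = finite_first_moment_measuresD[OF X(1)[OF True]]
    have "emeasure (K v) UNIV = ennreal (1 / w v) * ennreal (w v)"
      using K_e[OF True, of UNIV] X(2)[OF True] finite_measure.emeasure_eq_measure[OF F(3)] by simp
    also have "\<dots> = 1"
      using wpos[OF True] by (simp flip: ennreal_mult')
    finally show ?thesis
      using sets_eq_imp_space_eq[OF K_sets, of v] by (intro prob_spaceI) simp
  next
    case False
    then show ?thesis by (simp add: K_def prob_space_return)
  qed
  have K_mean: "(LINT y|K v. y) = m v" if "v \<in> I" for v
  proof -
    note F = finite_first_moment_measuresD[OF X(1)[OF that]]
    have "(LINT y|K v. y) = (LINT y|X v. 1 / w v * y)"
      unfolding K_def using that wpos[OF that] F(1)
      by (simp add: integral_density measurable_ident_sets)
    also have "\<dots> = m v"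
      using X(3)[OF that] wpos[OF that] by simp
    finally show ?thesis .
  qed
  \<comment> \<open>Every function on a discrete space is measurable, and a simple function is
    measurable into the discrete space.\<close>
  have "K \<in> count_space UNIV \<rightarrow>\<^sub>M prob_algebra borel"
    using K_sets K_prob by (auto simp: space_prob_algebra)
  from measurable_compose[OF sm this] have \<kappa>: "(\<lambda>x. K (s x)) \<in> borel \<rightarrow>\<^sub>M prob_algebra borel" .
  have s_in: "AE x in \<eta>. s x \<in> I"
  proof -
    have "AE x in \<eta>. \<forall>v\<in>range s - I. x \<notin> s -` {v}"
    proof (rule AE_finite_allI)
      fix v assume "v \<in> range s - I"
      then have "measure \<eta> (s -` {v}) = 0"
        using measure_nonneg[of \<eta> "s -` {v}"] unfolding I_def by (auto simp: not_less intro: antisym)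
      then have "s -` {v} \<in> null_sets \<eta>"
        using ms by (intro null_setsI) (simp_all add: emeasure_eq_measure)
      then show "AE x in \<eta>. x \<notin> s -` {v}" by (rule AE_not_in)
    qed (use fin in auto)
    then show ?thesis by eventually_elim auto
  qed
  have marg: "(\<integral>\<^sup>+ x. emeasure (K (s x)) B \<partial>\<eta>) = emeasure \<xi> B" if B: "B \<in> sets borel" for B
  proof -
    have fI: "finite I" using fin by (auto simp: I_def)
    have "(\<integral>\<^sup>+ x. emeasure (K (s x)) B \<partial>\<eta>) =
        (\<integral>\<^sup>+ x. (\<Sum>v\<in>I. emeasure (K v) B * indicator (s -` {v}) x) \<partial>\<eta>)"
    proof (rule nn_integral_cong_AE)
      show "AE x in \<eta>. emeasure (K (s x)) B = (\<Sum>v\<in>I. emeasure (K v) B * indicator (s -` {v}) x)"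
        using s_in
      proof eventually_elim
        case (elim x)
        have "(\<Sum>v\<in>I. emeasure (K v) B * indicator (s -` {v}) x) =
            (\<Sum>v\<in>I. if v = s x then emeasure (K (s x)) B else 0)"
          by (intro sum.cong) (auto simp: indicator_def)
        with elim fI show ?case by simp
      qed
    qed
    also have "\<dots> = (\<Sum>v\<in>I. emeasure (K v) B * emeasure \<eta> (s -` {v}))"
      using ms by (subst nn_integral_sum) (auto intro!: sum.cong nn_integral_cmult_indicator)
    also have "\<dots> = (\<Sum>v\<in>I. emeasure (X v) B)"
    proof (rule sum.cong[OF refl])
      fix v assume v: "v \<in> I"
      have "emeasure (K v) B * emeasure \<eta> (s -` {v}) = (ennreal (1 / w v) * ennreal (w v)) * emeasure (X v) B"
        by (simp add: K_e[OF v B] w_def emeasure_eq_measure ac_simps)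
      also have "ennreal (1 / w v) * ennreal (w v) = 1"
        using wpos[OF v] by (simp flip: ennreal_mult')
      finally show "emeasure (K v) B * emeasure \<eta> (s -` {v}) = emeasure (X v) B" by simp
    qed
    finally show ?thesis using X(4)[OF B] by simp
  qed
  obtain \<pi> where \<pi>: "\<pi> \<in> couplings \<eta> \<xi>" "disintegration \<pi> \<eta> (\<lambda>x. K (s x))"
    using exists_coupling_of_kernel[OF D(1) E(1) \<kappa> marg] by blast
  have hi: "integrable \<eta> (\<lambda>x. h (x - S x))"
  proof (rule Bochner_Integration.integrable_bound)
    show "integrable \<eta> (\<lambda>x. \<bar>h 0\<bar> + \<bar>x\<bar> + \<bar>S x\<bar>)"
      using D(4) Si by simp
    have "\<bar>h (x - S x)\<bar> \<le> \<bar>h 0\<bar> + \<bar>x\<bar> + \<bar>S x\<bar>" for x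
      using h(3)[of "x - S x" 0] by linarith
    then show "AE x in \<eta>. norm (h (x - S x)) \<le> norm (\<bar>h 0\<bar> + \<bar>x\<bar> + \<bar>S x\<bar>)"
      by (intro AE_I2) (smt (verit) real_norm_def)
  qed measurable
  have ss: "integrable \<eta> (\<lambda>x. \<bar>S x - s x\<bar>)" "integrable \<eta> (\<lambda>x. \<bar>s x - m (s x)\<bar>)"
    "integrable \<eta> (\<lambda>x. \<bar>S x - m (s x)\<bar>)"
    using Si si gi[of m] by auto
  \<comment> \<open>On the fibre over \<open>v\<close> the integrand is constant, and
    \<open>w v\<close> times it is the absolute value of the integral of S - v. The distance from s
    to the barycentre is thus at most that from S to s, which accounts for the factor 2.\<close>
  have "(LINT x|\<eta>. \<bar>s x - m (s x)\<bar>) = (\<Sum>v\<in>I. N v (\<lambda>x. \<bar>s x - m (s x)\<bar>))"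
    by (rule sum_N[OF ss(2)])
  also have "\<dots> \<le> (\<Sum>v\<in>I. N v (\<lambda>x. \<bar>S x - s x\<bar>))"
  proof (rule sum_mono)
    fix v assume v: "v \<in> I"
    have "N v (\<lambda>x. \<bar>s x - m (s x)\<bar>) = N v (\<lambda>x. \<bar>v - m v\<bar>)"
      unfolding N_def by (intro Bochner_Integration.integral_cong) (auto simp: indicator_def)
    also have "\<dots> = \<bar>w v * v - w v * m v\<bar>"
      unfolding right_diff_distrib[symmetric] using wpos[OF v] by (simp add: N_const abs_mult)
    also have "\<dots> = \<bar>N v (\<lambda>x. S x - v)\<bar>"
      using wm[OF v] Si by (subst N_diff) (auto simp: N_const mult.commute)
    also have "\<dots> \<le> N v (\<lambda>x. \<bar>S x - s x\<bar>)"
    proof (rule abs_leI)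
      show "N v (\<lambda>x. S x - v) \<le> N v (\<lambda>x. \<bar>S x - s x\<bar>)"
        using Si ss by (intro N_mono) auto
      have "- N v (\<lambda>x. S x - v) = N v (\<lambda>x. v - S x)"
        using Si by (subst (1 2) N_diff) auto
      also have "\<dots> \<le> N v (\<lambda>x. \<bar>S x - s x\<bar>)"
        using Si ss by (intro N_mono) auto
      finally show "- N v (\<lambda>x. S x - v) \<le> N v (\<lambda>x. \<bar>S x - s x\<bar>)" .
    qed
    finally show "N v (\<lambda>x. \<bar>s x - m (s x)\<bar>) \<le> N v (\<lambda>x. \<bar>S x - s x\<bar>)" .
  qed
  also have "\<dots> = (LINT x|\<eta>. \<bar>S x - s x\<bar>)"
    by (rule sum_N[OF ss(1), symmetric])
  finally have smb: "(LINT x|\<eta>. \<bar>s x - m (s x)\<bar>) \<le> (LINT x|\<eta>. \<bar>S x - s x\<bar>)" .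
  have "(LINT x|\<eta>. \<bar>S x - m (s x)\<bar>) \<le> (LINT x|\<eta>. \<bar>S x - s x\<bar> + \<bar>s x - m (s x)\<bar>)"
    using ss by (intro integral_mono) auto
  also have "\<dots> \<le> 2 * (LINT x|\<eta>. \<bar>S x - s x\<bar>)"
    using ss smb by simp
  finally have Sm2: "(LINT x|\<eta>. \<bar>S x - m (s x)\<bar>) \<le> 2 * (LINT x|\<eta>. \<bar>S x - s x\<bar>)" .
  have "weak_transport_cost h \<eta> \<xi> \<le> (\<integral>\<^sup>+ x. ennreal (h (x - (LINT y|K (s x). y))) \<partial>\<eta>)"
    unfolding weak_transport_cost_def using \<pi> by (intro INF_lower2[of "(\<pi>, \<lambda>x. K (s x))"]) auto
  also have "\<dots> \<le> (\<integral>\<^sup>+ x. ennreal (h (x - S x) + \<bar>S x - m (s x)\<bar>) \<partial>\<eta>)"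
  proof (rule nn_integral_mono_AE)
    show "AE x in \<eta>. ennreal (h (x - (LINT y|K (s x). y))) \<le> ennreal (h (x - S x) + \<bar>S x - m (s x)\<bar>)"
      using s_in
    proof eventually_elim
      case (elim x)
      show ?case
        using h(3)[of "x - m (s x)" "x - S x"] by (simp add: K_mean[OF elim]) (intro ennreal_leI, linarith)
    qed
  qed
  also have "\<dots> = ennreal (LINT x|\<eta>. h (x - S x) + \<bar>S x - m (s x)\<bar>)"
    using hi ss h(2) by (intro nn_integral_eq_integral) auto
  also have "\<dots> \<le> ennreal ((LINT x|\<eta>. h (x - S x)) + 2 * (LINT x|\<eta>. \<bar>S x - s x\<bar>))"
    using hi ss Sm2 by (intro ennreal_leI) simp
  finally show ?thesis .
qed

text \<open>The left side does not depend on the simple function, so the error may be sent to 0. The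
  approximants satisfy |s i| \<le> 2 |S|, which gives the integrable bound 3 |S| for dominated
  convergence.\<close>

lemma weak_transport_cost_le:
  fixes h :: "real \<Rightarrow> real"
  assumes \<eta>: "\<eta> \<in> \<M>" and \<xi>: "\<xi> \<in> \<M>" and S: "dominated_map \<eta> \<xi> S"
    and h: "h \<in> borel_measurable borel" "\<And>x. 0 \<le> h x" "\<And>x y. \<bar>h x - h y\<bar> \<le> \<bar>x - y\<bar>"
  shows "weak_transport_cost h \<eta> \<xi> \<le> ennreal (LINT x|\<eta>. h (x - S x))"
proof -
  note D = finite_first_moment_measuresD[OF \<eta>]
  have Sm: "S \<in> borel_measurable \<eta>" and Si: "integrable \<eta> S"
    using S by (auto simp: dominated_map_def)
  obtain s where s: "\<And>i. simple_function \<eta> (s i)" "\<And>x. (\<lambda>i. s i x) \<longlonglongrightarrow> S x"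
      "\<And>i x. \<bar>s i x\<bar> \<le> 2 * \<bar>S x\<bar>"
    using borel_measurable_implies_sequence_metric[OF Sm, of 0] D(2) by auto
  have "(\<lambda>i. LINT x|\<eta>. \<bar>S x - s i x\<bar>) \<longlonglongrightarrow> (LINT x|\<eta>. 0)"
  proof (rule integral_dominated_convergence[where w = "\<lambda>x. 3 * \<bar>S x\<bar>"])
    show "AE x in \<eta>. (\<lambda>i. \<bar>S x - s i x\<bar>) \<longlonglongrightarrow> 0"
    proof (rule AE_I2)
      show "(\<lambda>i. \<bar>S x - s i x\<bar>) \<longlonglongrightarrow> 0" for x
        using tendsto_rabs[OF tendsto_diff[OF tendsto_const[of "S x"] s(2)[of x]]] by simp
    qed
    show "AE x in \<eta>. norm \<bar>S x - s i x\<bar> \<le> 3 * \<bar>S x\<bar>" for i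
    proof (rule AE_I2)
      show "norm \<bar>S x - s i x\<bar> \<le> 3 * \<bar>S x\<bar>" for x
        using s(3)[of i x] by simp
    qed
    show "(\<lambda>x. \<bar>S x - s i x\<bar>) \<in> borel_measurable \<eta>" for i
      using Sm borel_measurable_simple_function[OF s(1)[of i]] by measurable
  qed (use Si in auto)
  then have "(\<lambda>i. ennreal ((LINT x|\<eta>. h (x - S x)) + 2 * (LINT x|\<eta>. \<bar>S x - s i x\<bar>)))
      \<longlonglongrightarrow> ennreal ((LINT x|\<eta>. h (x - S x)) + 2 * 0)"
    by (intro tendsto_intros) simp
  moreover have "weak_transport_cost h \<eta> \<xi> \<le>
      ennreal ((LINT x|\<eta>. h (x - S x)) + 2 * (LINT x|\<eta>. \<bar>S x - s i x\<bar>))" for i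
    by (rule weak_transport_cost_le_simple[OF \<eta> \<xi> S s(1) h])
  ultimately show ?thesis
    by (intro tendsto_lowerbound[where F = sequentially]) auto
qed

section \<open>Optimal maps minimise the hinge costs\<close>

text \<open>A call payoff for \<open>s = 1\<close> and a put payoff for \<open>s = -1\<close>. The
  condition \<open>0 \<le> s * c\<close> makes it vanish at 0, as a cost function must; every strike
  \<open>c\<close> satisfies it for one of the two orientations.\<close>

definition hinge :: "real \<Rightarrow> real \<Rightarrow> real \<Rightarrow> real" where
  "hinge s c z = max (s * (z - c)) 0"

lemma hinge_nonneg: "0 \<le> hinge s c z"
  by (simp add: hinge_def)

lemma hinge_lipschitz:
  assumes "\<bar>s\<bar> = 1"
  shows "\<bar>hinge s c x - hinge s c y\<bar> \<le> \<bar>x - y\<bar>"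
  using assms unfolding hinge_def by (cases "s = 1") (auto simp: abs_if max_def split: if_splits)

lemma hinge_measurable [measurable]: "hinge s c \<in> borel_measurable borel"
  unfolding hinge_def[abs_def] by measurable

lemma convex_on_hinge: "convex_on UNIV (hinge s c)"
proof (rule convex_onI)
  fix t x y :: real assume t: "0 < t" "t < 1"
  have "s * ((1 - t) * x + t * y - c) = (1 - t) * (s * (x - c)) + t * (s * (y - c))"
    by (simp add: algebra_simps)
  then show "hinge s c ((1 - t) *\<^sub>R x + t *\<^sub>R y) \<le> (1 - t) * hinge s c x + t * hinge s c y"
    using max_0_convex_comb[of t "s * (x - c)" "s * (y - c)"] t by (simp add: hinge_def)
qed simp

lemma cost_function_hinge:
  assumes "0 \<le> s * c"
  shows "cost_function (hinge s c)"
  using assms convex_on_hinge by (auto simp: cost_function_def hinge_nonneg) (simp add: hinge_def)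

lemma integrable_hinge:
  assumes "finite_measure \<eta>" "integrable \<eta> f"
  shows "integrable \<eta> (\<lambda>x. hinge s c (f x))"
  using assms unfolding hinge_def
  by (auto intro!: integrable_max integrable_diff integrable_mult_right finite_measure.integrable_const)

section \<open>Test functions for the convex order\<close>

lemma extended_integral_integrable:
  assumes "integrable \<eta> f"
  shows "extended_integral \<eta> f = ereal (LINT x|\<eta>. f x)"
proof -
  have "(\<integral>\<^sup>+ x. ennreal (f x) \<partial>\<eta>) < \<infinity>" "(\<integral>\<^sup>+ x. ennreal (- f x) \<partial>\<eta>) < \<infinity>"
    using assms by (auto simp: real_integrable_def less_top)
  then show ?thesis
    unfolding extended_integral_def real_lebesgue_integral_def[OF assms]
    by (cases "\<integral>\<^sup>+ x. ennreal (f x) \<partial>\<eta>"; cases "\<integral>\<^sup>+ x. ennreal (- f x) \<partial>\<eta>")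
       (auto simp: enn2ereal_ennreal)
qed

lemma convex_order_integral_le:
  assumes "\<eta> \<le>\<^sub>c \<xi>" "convex_on UNIV f" "integrable \<eta> f" "integrable \<xi> f"
  shows "(LINT x|\<eta>. f x) \<le> (LINT x|\<xi>. f x)"
  using assms by (auto simp: convex_order_def extended_integral_integrable dest!: spec)

lemma optimal_map_dominated:
  assumes \<eta>: "\<eta> \<in> \<M>" and \<xi>: "\<xi> \<in> \<M>" and T: "optimal_map \<eta> \<xi> T"
  shows "dominated_map \<eta> \<xi> T"
proof -
  note D = finite_first_moment_measuresD[OF \<eta>] and E = finite_first_moment_measuresD[OF \<xi>]
  interpret finite_measure \<eta> by (rule D)
  have lip: "1-lipschitz_on UNIV T" and le: "distr \<eta> borel T \<le>\<^sub>c \<xi>"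
    using T by (auto simp: optimal_map_def admissible_def)
  have Tm: "T \<in> borel_measurable borel"
    using lipschitz_on_continuous_on[OF lip] by (rule borel_measurable_continuous_onI)
  then have Tm': "T \<in> borel_measurable \<eta>"
    using measurable_cong_sets[OF D(1) refl] by blast
  have Ti: "integrable \<eta> T"
  proof (rule Bochner_Integration.integrable_bound)
    show "integrable \<eta> (\<lambda>x. \<bar>T 0\<bar> + \<bar>x\<bar>)"
      using D(4) by simp
    have "\<bar>T x\<bar> \<le> \<bar>T 0\<bar> + \<bar>x\<bar>" for x
      using lipschitz_onD[OF lip, of x 0] by (simp add: dist_real_def)
    then show "AE x in \<eta>. norm (T x) \<le> norm (\<bar>T 0\<bar> + \<bar>x\<bar>)" by simp
  qed (rule Tm')
  have ord: "(LINT x|\<eta>. f (T x)) \<le> (LINT x|\<xi>. f x)"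
    if "convex_on UNIV f" "integrable \<eta> (\<lambda>x. f (T x))" "integrable \<xi> f" "f \<in> borel_measurable borel"
    for f :: "real \<Rightarrow> real"
    using convex_order_integral_le[OF le that(1) _ that(3)] that Tm'
    by (simp add: integral_distr integrable_distr_eq)
  have convex_affine: "convex_on UNIV (\<lambda>x::real. a * x + b)" for a b
    by (rule convex_onI) (simp_all add: algebra_simps)
  \<comment> \<open>An affine function and its negative are both convex, so the inequalities for
    \<plusminus>1 and \<plusminus>x turn into equality of masses and means.\<close>
  have affine: "(LINT x|\<eta>. a * T x + b) \<le> (LINT x|\<xi>. a * x + b)" for a b
  proof (rule ord[OF convex_affine])
    show "integrable \<eta> (\<lambda>x. a * T x + b)"
      using Ti by simp
    show "integrable \<xi> (\<lambda>x. a * x + b)"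
      using E(4) finite_measure.integrable_const[OF E(3), of b] by simp
  qed simp
  have "measure \<eta> UNIV = measure \<xi> UNIV"
    using affine[of 0 1] affine[of 0 "-1"] D(2) E(2) by simp
  moreover have "(LINT x|\<eta>. T x) = (LINT x|\<xi>. x)"
    using affine[of 1 0] affine[of "-1" 0] by simp
  moreover have "(LINT x|\<eta>. max (k - T x) 0) \<le> put_fun \<xi> k" for k
  proof -
    have eq: "hinge (-1) k = (\<lambda>x. max (k - x) 0)"
      by (auto simp: hinge_def)
    show ?thesis
      unfolding put_fun_def using convex_on_hinge[of "-1" k, unfolded eq]
        integrable_put_call(1)[OF D(3) Ti] integrable_put_call(1)[OF E(3,4)]
      by (intro ord) auto
  qed
  ultimately show ?thesis
    using Tm Ti by (simp add: dominated_map_def)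
qed

text \<open>
  Kantorovich duality for the cost \<open>(s (x - y - c))\<^sup>+\<close>: as \<open>x - T x\<close> is non-decreasing, it passes
  \<open>c\<close> at some \<open>t\<close> (or never), and \<open>(s (x - t))\<^sup>+ - (s (y + c - t))\<^sup>+\<close> is a dual potential that is
  tight on the graph of \<open>T\<close>.
\<close>

lemma hinge_potentials:
  fixes T :: "real \<Rightarrow> real"
  assumes mono: "mono T" and lip: "1-lipschitz_on UNIV T" and s: "\<bar>s\<bar> = 1"
  obtains a b a' b' t t' :: real where
    "\<And>x y. a * x + b * max (s * (x - t)) 0 + a' - a * y - b * max (s * (y - t')) 0 \<le> hinge s c (x - y)"
    "\<And>x. a * x + b * max (s * (x - t)) 0 + a' - a * T x - b * max (s * (T x - t')) 0 = hinge s c (x - T x)"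
proof -
  have T: "0 \<le> T x - T y" "T x - T y \<le> x - y" if "y \<le> x" for x y
    using monoD[OF mono that] lipschitz_onD[OF lip, of x y] that by (auto simp: dist_real_def)
  \<comment> \<open>If x - T x stays on one side of c, the hinge is affine along the graph of T: the
    potential is 0 or s (x - y - c).\<close>
  consider (neg) "\<And>x. s * (x - T x - c) \<le> 0" | (pos) "\<And>x. 0 \<le> s * (x - T x - c)"
    | (mid) x y where "x - T x < c" "c < y - T y"
  proof -
    have "\<exists>x y. x - T x < c \<and> c < y - T y"
      if "0 < s * (x - T x - c)" "s * (y - T y - c) < 0" for x y
    proof (cases "s = 1")
      case True
      with that show ?thesis by (intro exI[of _ y] exI[of _ x]) auto
    next
      case False
      with s have "s = -1" by auto
      with that show ?thesis by (intro exI[of _ x] exI[of _ y]) auto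
    qed
    then show thesis using that by (meson not_le)
  qed
  then show thesis
  proof cases
    case neg
    then show thesis
      by (intro that[of 0 0 _ 0]) (auto simp: hinge_def)
  next
    case pos
    have "s * x + 0 * max (s * (x - 0)) 0 + - s * c - s * T x - 0 * max (s * (T x - 0)) 0 = hinge s c (x - T x)" for x
      using pos[of x] by (simp add: hinge_def algebra_simps)
    then show thesis
      by (rule that[rotated]) (simp add: hinge_def algebra_simps)
  next
    case mid
    have "continuous_on {x..y} (\<lambda>u. u - T u)"
      using continuous_on_subset[OF lipschitz_on_continuous_on[OF lip]]
      by (intro continuous_on_diff continuous_on_id) auto
    moreover have "x \<le> y"
      using T(2)[of y x] mid by (cases "x \<le> y") auto
    ultimately obtain t where t: "t - T t = c"
      using IVT'[of "\<lambda>u. u - T u" x c y] mid by auto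
    \<comment> \<open>Here t - c = T t. Since T is monotone and 1-Lipschitz, the increments x - t
      and T x - T t and their difference never have opposite signs, so the positive parts subtract
      exactly.\<close>
    have "0 * x + 1 * max (s * (x - t)) 0 + 0 - 0 * T x - 1 * max (s * (T x - (t - c))) 0 = hinge s c (x - T x)" for x
      using T[of x t] T[of t x] t s
      by (cases "s = 1"; cases "x \<le> t") (auto simp: hinge_def max_def abs_if split: if_splits)
    \<comment> \<open>Subadditivity of the positive part, applied to x - t = (x - y - c) + (y + c -
      t).\<close>
    moreover have "0 * x + 1 * max (s * (x - t)) 0 + 0 - 0 * y - 1 * max (s * (y - (t - c))) 0 \<le> hinge s c (x - y)" for x y
      using s by (cases "s = 1") (auto simp: hinge_def max_def abs_if split: if_splits)
    ultimately show thesis by (rule that[rotated])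
  qed
qed

text \<open>The integral of the difference of the potentials depends only on the marginals. It is at
  most the cost of the given coupling and equals the cost on the graph of T.\<close>

lemma transport_cost_hinge_ge:
  assumes \<eta>: "\<eta> \<in> \<M>" and mono: "mono T" and lip: "1-lipschitz_on UNIV T" and Ti: "integrable \<eta> T"
    and s: "\<bar>s\<bar> = 1"
  shows "ennreal (LINT x|\<eta>. hinge s c (x - T x)) \<le> transport_cost (hinge s c) \<eta> (distr \<eta> borel T)"
  unfolding transport_cost_def
proof (rule INF_greatest)
  note D = finite_first_moment_measuresD[OF \<eta>]
  fix \<pi> assume "\<pi> \<in> couplings \<eta> (distr \<eta> borel T)"
  then have sets\<pi>: "sets \<pi> = sets borel" and fst\<pi>: "distr \<pi> borel fst = \<eta>"
    and snd\<pi>: "distr \<pi> borel snd = distr \<eta> borel T"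
    by (auto simp: couplings_def)
  have Tm: "T \<in> borel_measurable \<eta>"
    using Ti by auto
  have sp\<pi>: "space \<pi> = UNIV" using sets_eq_imp_space_eq[OF sets\<pi>] by simp
  have fst_m: "fst \<in> \<pi> \<rightarrow>\<^sub>M (borel :: real measure)" and snd_m: "snd \<in> \<pi> \<rightarrow>\<^sub>M (borel :: real measure)"
    unfolding measurable_cong_sets[OF sets\<pi> refl]
    by (auto intro!: borel_measurable_continuous_onI continuous_intros)
  have "emeasure \<pi> UNIV = emeasure \<eta> UNIV"
    using fst_m sp\<pi> by (simp add: fst\<pi>[symmetric] emeasure_distr)
  then have fin\<pi>: "finite_measure \<pi>"
    using finite_measure.emeasure_finite[OF D(3), of UNIV] sp\<pi> by (intro finite_measureI) simp
  interpret \<pi>: finite_measure \<pi> by (rule fin\<pi>)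
  interpret \<eta>: finite_measure \<eta> by (rule D)
  have fst_int: "integrable \<pi> (\<lambda>z. g (fst z))" "(LINT z|\<pi>. g (fst z)) = (LINT x|\<eta>. g x)"
    if "g \<in> borel_measurable borel" "integrable \<eta> g" for g :: "real \<Rightarrow> real"
    using that fst_m integrable_distr_eq[OF fst_m that(1)] integral_distr[OF fst_m that(1)]
    by (simp_all add: fst\<pi>)
  have snd_int: "integrable \<pi> (\<lambda>z. g (snd z))" "(LINT z|\<pi>. g (snd z)) = (LINT x|\<eta>. g (T x))"
    if "g \<in> borel_measurable borel" "integrable \<eta> (\<lambda>x. g (T x))" for g :: "real \<Rightarrow> real"
    using that integrable_distr_eq[OF snd_m that(1)] integral_distr[OF snd_m that(1)]
      integrable_distr_eq[OF Tm that(1)] integral_distr[OF Tm that(1)]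
    by (simp_all add: snd\<pi>)
  obtain a b a' t t' where
    le: "\<And>x y. a * x + b * max (s * (x - t)) 0 + a' - a * y - b * max (s * (y - t')) 0 \<le> hinge s c (x - y)"
    and eq: "\<And>x. a * x + b * max (s * (x - t)) 0 + a' - a * T x - b * max (s * (T x - t')) 0 = hinge s c (x - T x)"
    by (rule hinge_potentials[OF mono lip s, of c]) blast
  define g1 where "g1 x = a * x + b * max (s * (x - t)) 0 + a'" for x
  define g2 where "g2 y = a * y + b * max (s * (y - t')) 0" for y
  have gm: "g1 \<in> borel_measurable borel" "g2 \<in> borel_measurable borel"
    unfolding g1_def g2_def by measurable
  have gi: "integrable \<eta> g1" "integrable \<eta> (\<lambda>x. g2 (T x))"
    unfolding g1_def g2_def using D(4) Ti
    by (auto intro!: integrable_max Bochner_Integration.integrable_add integrable_diff integrable_mult_right)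
  have hi: "integrable \<pi> (\<lambda>z. hinge s c (fst z - snd z))"
    by (intro integrable_hinge[OF fin\<pi>] Bochner_Integration.integrable_diff
        fst_int(1)[of "\<lambda>x. x"] snd_int(1)[of "\<lambda>x. x"] D(4) Ti) simp_all
  have "(LINT x|\<eta>. hinge s c (x - T x)) = (LINT x|\<eta>. g1 x - g2 (T x))"
    using eq by (intro Bochner_Integration.integral_cong) (auto simp: g1_def g2_def algebra_simps)
  also have "\<dots> = (LINT z|\<pi>. g1 (fst z) - g2 (snd z))"
    using gi fst_int[OF gm(1) gi(1)] snd_int[OF gm(2) gi(2)] by simp
  also have "\<dots> \<le> (LINT z|\<pi>. hinge s c (fst z - snd z))"
  proof (rule integral_mono)
    show "integrable \<pi> (\<lambda>z. g1 (fst z) - g2 (snd z))"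
      using fst_int(1)[OF gm(1) gi(1)] snd_int(1)[OF gm(2) gi(2)] by simp
    show "g1 (fst z) - g2 (snd z) \<le> hinge s c (fst z - snd z)" for z
      using le[of "fst z" "snd z"] by (simp add: g1_def g2_def)
  qed (rule hi)
  finally have "ennreal (LINT x|\<eta>. hinge s c (x - T x)) \<le> ennreal (LINT z|\<pi>. hinge s c (fst z - snd z))"
    by (rule ennreal_leI)
  also have "\<dots> = (\<integral>\<^sup>+ z. ennreal (hinge s c (fst z - snd z)) \<partial>\<pi>)"
    using hi hinge_nonneg by (intro nn_integral_eq_integral[symmetric]) auto
  finally show "ennreal (LINT x|\<eta>. hinge s c (x - T x)) \<le> (\<integral>\<^sup>+ (x, y). ennreal (hinge s c (x - y)) \<partial>\<pi>)"
    unfolding case_prod_unfold .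
qed

text \<open>The equality of weak and ordinary cost in the definition of an optimal map links the
  lower bound from the potentials of T with the upper bound from the kernels that approximate
  S.\<close>

lemma optimal_map_minimises_hinge:
  assumes \<eta>: "\<eta> \<in> \<M>" and \<xi>: "\<xi> \<in> \<M>" and T: "optimal_map \<eta> \<xi> T" and S: "dominated_map \<eta> \<xi> S"
    and s: "\<bar>s\<bar> = 1" "0 \<le> s * c"
  shows "(LINT x|\<eta>. hinge s c (x - T x)) \<le> (LINT x|\<eta>. hinge s c (x - S x))"
proof -
  have "ennreal (LINT x|\<eta>. hinge s c (x - T x)) \<le> transport_cost (hinge s c) \<eta> (distr \<eta> borel T)"
    using T optimal_map_dominated[OF \<eta> \<xi> T] s
    by (intro transport_cost_hinge_ge \<eta>) (auto simp: optimal_map_def admissible_def dominated_map_def)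
  also have "\<dots> = weak_transport_cost (hinge s c) \<eta> \<xi>"
    using T cost_function_hinge[OF s(2)] by (simp add: optimal_map_def)
  also have "\<dots> \<le> ennreal (LINT x|\<eta>. hinge s c (x - S x))"
    by (rule weak_transport_cost_le[OF \<eta> \<xi> S hinge_measurable hinge_nonneg hinge_lipschitz[OF s(1)]])
  finally show ?thesis
    by (subst (asm) ennreal_le_iff) (auto intro!: Bochner_Integration.integral_nonneg hinge_nonneg)
qed

section \<open>Uniqueness on a Borel set\<close>

lemma sets_restrict_measure [simp]: "sets (restrict_measure \<eta> A) = sets \<eta>"
  by (simp add: restrict_measure_def)

lemma integral_restrict_measure:
  fixes f :: "real \<Rightarrow> real"
  assumes "A \<in> sets \<eta>" "f \<in> borel_measurable \<eta>"
  shows "(LINT x|restrict_measure \<eta> A. f x) = (LINT x|\<eta>. indicator A x * f x)"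
    "integrable (restrict_measure \<eta> A) f \<longleftrightarrow> integrable \<eta> (\<lambda>x. indicator A x * f x)"
proof -
  have eq: "restrict_measure \<eta> A = density \<eta> (\<lambda>x. ennreal (indicator A x))"
    by (simp add: restrict_measure_def ennreal_indicator)
  show "(LINT x|restrict_measure \<eta> A. f x) = (LINT x|\<eta>. indicator A x * f x)"
    unfolding eq using assms by (subst integral_density) auto
  show "integrable (restrict_measure \<eta> A) f \<longleftrightarrow> integrable \<eta> (\<lambda>x. indicator A x * f x)"
    unfolding eq using assms by (subst integrable_density) auto
qed

lemma emeasure_restrict_measure:
  assumes "A \<in> sets \<eta>" "B \<in> sets \<eta>"
  shows "emeasure (restrict_measure \<eta> A) B = emeasure \<eta> (A \<inter> B)"
  using assms unfolding restrict_measure_def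
  by (subst emeasure_density) (auto simp flip: indicator_inter_arith)

lemma restrict_measure_finite_first_moment:
  assumes \<eta>: "\<eta> \<in> \<M>" and A: "A \<in> sets borel"
  shows "restrict_measure \<eta> A \<in> \<M>" "measure (restrict_measure \<eta> A) UNIV = measure \<eta> A"
proof -
  note D = finite_first_moment_measuresD[OF \<eta>]
  have e: "emeasure (restrict_measure \<eta> A) UNIV = emeasure \<eta> A"
    using A D(1) by (subst emeasure_restrict_measure) auto
  then show "measure (restrict_measure \<eta> A) UNIV = measure \<eta> A"
    by (simp add: measure_def)
  have "space (restrict_measure \<eta> A) = UNIV"
    using D(2) by (simp add: restrict_measure_def)
  with e have "finite_measure (restrict_measure \<eta> A)"
    using finite_measure.emeasure_finite[OF D(3), of A] by (intro finite_measureI) simp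
  moreover have "integrable (restrict_measure \<eta> A) (\<lambda>x. x)"
    using integrable_mult_indicator[of A \<eta> "\<lambda>x. x"] D A
    by (subst integral_restrict_measure) (auto simp: measurable_ident_sets)
  ultimately show "restrict_measure \<eta> A \<in> \<M>"
    using D(1) by (intro finite_first_moment_measuresI) simp_all
qed

lemma AE_restrict_measure:
  assumes "A \<in> sets \<eta>"
  shows "(AE x in restrict_measure \<eta> A. P x) \<longleftrightarrow> (AE x in \<eta>. x \<in> A \<longrightarrow> P x)"
proof -
  have "(AE x in restrict_measure \<eta> A. P x) \<longleftrightarrow> (AE x in \<eta>. 0 < (indicator A x :: ennreal) \<longrightarrow> P x)"
    unfolding restrict_measure_def using assms by (intro AE_density) simp
  then show ?thesis by (simp add: indicator_def)
qed

lemma dominated_map_midpoint: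
  assumes \<eta>: "\<eta> \<in> \<M>" and S: "dominated_map \<eta> \<xi> S" and T: "dominated_map \<eta> \<xi> T"
  shows "dominated_map \<eta> \<xi> (\<lambda>x. (S x + T x) / 2)"
proof -
  note D = finite_first_moment_measuresD[OF \<eta>]
  have i: "integrable \<eta> S" "integrable \<eta> T"
    using S T by (auto simp: dominated_map_def)
  have im: "integrable \<eta> (\<lambda>x. (S x + T x) / 2)"
    using i by simp
  have "(LINT x|\<eta>. max (k - (S x + T x) / 2) 0) \<le> put_fun \<xi> k" for k
  proof -
    note iS = integrable_put_call(1)[OF D(3) i(1), of k] and iT = integrable_put_call(1)[OF D(3) i(2), of k]
    have "max (k - (a + b) / 2) 0 \<le> max (k - a) 0 / 2 + max (k - b) 0 / 2" for a b :: real
      by (simp add: max_def field_simps)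
    then have "(LINT x|\<eta>. max (k - (S x + T x) / 2) 0) \<le> (LINT x|\<eta>. max (k - S x) 0 / 2 + max (k - T x) 0 / 2)"
      using iS iT by (intro integral_mono integrable_put_call(1)[OF D(3) im]) auto
    also have "\<dots> \<le> put_fun \<xi> k / 2 + put_fun \<xi> k / 2"
    proof -
      have "(LINT x|\<eta>. max (k - S x) 0) \<le> put_fun \<xi> k" "(LINT x|\<eta>. max (k - T x) 0) \<le> put_fun \<xi> k"
        using S T by (auto simp: dominated_map_def)
      then show ?thesis
        using iS iT by simp
    qed
    finally show ?thesis by simp
  qed
  then show ?thesis
    using S T i by (auto simp: dominated_map_def)
qed

text \<open>A hinge is strictly convex only across its kink. This strict inequality is the source of
  uniqueness.\<close>

lemma hinge_midpoint_less:
  assumes "\<bar>s\<bar> = 1" "u < c" "c < v"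
  shows "hinge s c ((u + v) / 2) < hinge s c u / 2 + hinge s c v / 2"
  using assms by (cases "s = 1") (auto simp: hinge_def max_def abs_if field_simps split: if_splits)

text \<open>
  Replacing \<open>W\<close> on \<open>A\<close> by any map dominated by \<open>\<xi>\<close> keeps it dominated by \<open>\<nu>\<close>. Hence on \<open>A\<close> both
  \<open>W\<close> and \<open>T\<close> minimise every hinge cost, and so does their midpoint. For every \<open>c\<close> the hinge at
  \<open>c\<close> is therefore affine between \<open>x - W x\<close> and \<open>x - T x\<close>, so no \<open>c\<close> separates these points.
\<close>

lemma optimal_map_eq_on:
  assumes \<mu>: "\<mu> \<in> \<M>" and \<nu>: "\<nu> \<in> \<M>" and \<xi>: "\<xi> \<in> \<M>" and A: "A \<in> sets borel"
    and W: "optimal_map \<mu> \<nu> W" and T: "optimal_map (restrict_measure \<mu> A) \<xi> T"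
    and dom: "dominated_map (restrict_measure \<mu> A) \<xi> W"
    and put: "\<And>k. put_fun \<xi> k + (LINT x|\<mu>. indicator (- A) x * max (k - W x) 0) \<le> put_fun \<nu> k"
  shows "AE x in \<mu>. x \<in> A \<longrightarrow> W x = T x"
proof -
  let ?\<eta> = "restrict_measure \<mu> A"
  note D = finite_first_moment_measuresD[OF \<mu>]
  have \<eta>: "?\<eta> \<in> \<M>" by (rule restrict_measure_finite_first_moment[OF \<mu> A])
  note E = finite_first_moment_measuresD[OF \<eta>]
  have A': "A \<in> sets \<mu>" using A D by simp
  have Wd: "dominated_map \<mu> \<nu> W" by (rule optimal_map_dominated[OF \<mu> \<nu> W])
  have Td: "dominated_map ?\<eta> \<xi> T" by (rule optimal_map_dominated[OF \<eta> \<xi> T])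
  have Wm: "W \<in> borel_measurable borel" and Wi: "integrable \<mu> W"
    using Wd by (auto simp: dominated_map_def)
  have split: "(LINT x|\<mu>. (if x \<in> A then f x else g x)) = (LINT x|?\<eta>. f x) + (LINT x|\<mu>. indicator (- A) x * g x)"
      "integrable \<mu> (\<lambda>x. if x \<in> A then f x else g x)"
    if fm: "f \<in> borel_measurable borel" and f: "integrable ?\<eta> f" and g: "integrable \<mu> g"
    for f g :: "real \<Rightarrow> real"
  proof -
    have fm': "f \<in> borel_measurable \<mu>" using fm measurable_cong_sets[OF D(1) refl] by blast
    have eq: "(\<lambda>x. if x \<in> A then f x else g x) = (\<lambda>x. indicator A x * f x + indicator (- A) x * g x)"
      by (auto simp: indicator_def)
    have i1: "integrable \<mu> (\<lambda>x. indicator A x * f x)"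
      using f integral_restrict_measure(2)[OF A' fm'] by simp
    have i2: "integrable \<mu> (\<lambda>x. indicator (- A) x * g x)"
      using integrable_mult_indicator[OF _ g, of "- A"] A D by (simp add: borel_comp)
    show "integrable \<mu> (\<lambda>x. if x \<in> A then f x else g x)"
      unfolding eq using i1 i2 by simp
    show "(LINT x|\<mu>. (if x \<in> A then f x else g x)) = (LINT x|?\<eta>. f x) + (LINT x|\<mu>. indicator (- A) x * g x)"
      unfolding eq integral_restrict_measure(1)[OF A' fm'] using i1 i2 by simp
  qed
  have W\<eta>: "integrable ?\<eta> W" using dom by (simp add: dominated_map_def)
  define mix where "mix S x = (if x \<in> A then S x else W x)" for S x
  have mix_dom: "dominated_map \<mu> \<nu> (mix S)" if S: "dominated_map ?\<eta> \<xi> S" for S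
  proof -
    have Sm[measurable]: "S \<in> borel_measurable borel" and Si: "integrable ?\<eta> S"
      using S by (auto simp: dominated_map_def)
    note [measurable] = Wm A
    have m: "mix S \<in> borel_measurable borel"
      unfolding mix_def[abs_def] by measurable
    have i: "integrable \<mu> (mix S)"
      unfolding mix_def[abs_def] by (rule split(2)[OF Sm Si Wi])
    have "(LINT x|\<mu>. mix S x) = (LINT x|\<mu>. mix W x)"
      unfolding mix_def split(1)[OF Sm Si Wi] split(1)[OF Wm W\<eta> Wi]
      using S dom by (simp add: dominated_map_def)
    also have "\<dots> = (LINT x|\<nu>. x)"
      using Wd by (simp add: mix_def dominated_map_def)
    finally have mean: "(LINT x|\<mu>. mix S x) = (LINT x|\<nu>. x)" .
    have "(LINT x|\<mu>. max (k - mix S x) 0) \<le> put_fun \<nu> k" for k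
    proof -
      have "(LINT x|\<mu>. max (k - mix S x) 0) = (LINT x|\<mu>. (if x \<in> A then max (k - S x) 0 else max (k - W x) 0))"
        by (intro Bochner_Integration.integral_cong) (auto simp: mix_def)
      also have "\<dots> = (LINT x|?\<eta>. max (k - S x) 0) + (LINT x|\<mu>. indicator (- A) x * max (k - W x) 0)"
        using integrable_put_call(1)[OF E(3) Si] integrable_put_call(1)[OF D(3) Wi]
        by (intro split(1)) measurable
      also have "\<dots> \<le> put_fun \<nu> k"
        using S put[of k] by (auto simp: dominated_map_def dest!: spec[of _ k])
      finally show ?thesis .
    qed
    with m i mean Wd show ?thesis by (simp add: dominated_map_def)
  qed
  have hint: "integrable ?\<eta> (\<lambda>x. hinge s c (x - S x))" "(\<lambda>x. hinge s c (x - S x)) \<in> borel_measurable borel"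
    if S: "dominated_map ?\<eta> \<xi> S" for S s c
  proof -
    have [measurable]: "S \<in> borel_measurable borel" and Si: "integrable ?\<eta> S"
      using S by (auto simp: dominated_map_def)
    show "(\<lambda>x. hinge s c (x - S x)) \<in> borel_measurable borel" by measurable
    show "integrable ?\<eta> (\<lambda>x. hinge s c (x - S x))"
      by (intro integrable_hinge[OF E(3)] Bochner_Integration.integrable_diff Si E(4))
  qed
  \<comment> \<open>\<open>mix W\<close> is W itself, and \<open>mix S\<close> differs from it only
    on A; the contributions from outside A cancel.\<close>
  have W_min: "(LINT x|?\<eta>. hinge s c (x - W x)) \<le> (LINT x|?\<eta>. hinge s c (x - S x))"
    if S: "dominated_map ?\<eta> \<xi> S" and s: "\<bar>s\<bar> = 1" "0 \<le> s * c" for S s c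
  proof -
    have gW: "integrable \<mu> (\<lambda>x. hinge s c (x - W x))"
      by (intro integrable_hinge[OF D(3)] Bochner_Integration.integrable_diff Wi D(4))
    have *: "(LINT x|\<mu>. hinge s c (x - mix S x)) =
        (LINT x|?\<eta>. hinge s c (x - S x)) + (LINT x|\<mu>. indicator (- A) x * hinge s c (x - W x))"
      if S: "dominated_map ?\<eta> \<xi> S" for S
    proof -
      have "(LINT x|\<mu>. hinge s c (x - mix S x)) =
          (LINT x|\<mu>. (if x \<in> A then hinge s c (x - S x) else hinge s c (x - W x)))"
        by (intro Bochner_Integration.integral_cong) (auto simp: mix_def)
      then show ?thesis
        using split(1)[OF hint(2,1)[OF S] gW] by simp
    qed
    have "(LINT x|\<mu>. hinge s c (x - mix W x)) \<le> (LINT x|\<mu>. hinge s c (x - mix S x))"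
      using optimal_map_minimises_hinge[OF \<mu> \<nu> W mix_dom[OF S] s] by (simp add: mix_def[of W])
    then show ?thesis
      unfolding *[OF S] *[OF dom] by simp
  qed
  have T_min: "(LINT x|?\<eta>. hinge s c (x - T x)) \<le> (LINT x|?\<eta>. hinge s c (x - S x))"
    if S: "dominated_map ?\<eta> \<xi> S" and s: "\<bar>s\<bar> = 1" "0 \<le> s * c" for S s c
    by (rule optimal_map_minimises_hinge[OF \<eta> \<xi> T S s])
  define Z where "Z x = (W x + T x) / 2" for x
  have Zd: "dominated_map ?\<eta> \<xi> Z"
    unfolding Z_def[abs_def] by (rule dominated_map_midpoint[OF \<eta> dom Td])
  \<comment> \<open>The orientation that makes the hinge at \<open>c\<close> a cost function, so
    that every real kink is available.\<close>
  define sg :: "real \<Rightarrow> real" where "sg c = (if 0 \<le> c then 1 else -1)" for c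
  have sg: "\<bar>sg c\<bar> = 1" "0 \<le> sg c * c" for c
    by (auto simp: sg_def)
  \<comment> \<open>The convexity defect at the midpoint. It is nonnegative pointwise, while its
    integral is at most 0 because neither W nor T costs more than Z.\<close>
  define gap where "gap c x = hinge (sg c) c (x - W x) / 2 + hinge (sg c) c (x - T x) / 2 - hinge (sg c) c (x - Z x)" for c x
  have "AE x in ?\<eta>. gap c x = 0" for c
  proof -
    note i = hint(1)[OF dom, of "sg c" c] hint(1)[OF Td, of "sg c" c] hint(1)[OF Zd, of "sg c" c]
    have nn: "0 \<le> gap c x" for x
      unfolding gap_def hinge_def Z_def sg_def by (simp add: max_def field_simps)
    have gi: "integrable ?\<eta> (gap c)"
      unfolding gap_def[abs_def] using i by simp
    have "(LINT x|?\<eta>. gap c x) = (LINT x|?\<eta>. hinge (sg c) c (x - W x)) / 2 +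
        (LINT x|?\<eta>. hinge (sg c) c (x - T x)) / 2 - (LINT x|?\<eta>. hinge (sg c) c (x - Z x))"
      unfolding gap_def using i by simp
    also have "\<dots> \<le> 0"
      using W_min[OF Zd sg, of c] T_min[OF Zd sg, of c] by simp
    moreover have "0 \<le> (LINT x|?\<eta>. gap c x)"
      using nn by (rule Bochner_Integration.integral_nonneg)
    ultimately have "(LINT x|?\<eta>. gap c x) = 0" by simp
    then show ?thesis
      using integral_nonneg_eq_0_iff_AE[OF gi] nn by simp
  qed
  \<comment> \<open>The exceptional null set depends on \<open>c\<close>. Rational kinks keep the
    union countable and still separate any two distinct displacements.\<close>
  then have "AE x in ?\<eta>. \<forall>c\<in>\<rat>. gap c x = 0"
    by (subst AE_ball_countable) (auto intro: countable_rat)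
  then have "AE x in ?\<eta>. W x = T x"
  proof eventually_elim
    case (elim x)
    have *: False if "u < c" "c < v" "c \<in> \<rat>" "{u, v} = {x - W x, x - T x}" for u v c
    proof -
      have "x - Z x = (u + v) / 2"
        using that(4) by (auto simp: Z_def doubleton_eq_iff field_simps)
      then have "hinge (sg c) c (x - Z x) = hinge (sg c) c ((u + v) / 2)"
        by (rule arg_cong)
      moreover have "gap c x = 0"
        using elim that(3) by blast
      moreover have "hinge (sg c) c (x - W x) + hinge (sg c) c (x - T x) = hinge (sg c) c u + hinge (sg c) c v"
        using that(4) by (auto simp: doubleton_eq_iff)
      ultimately show False
        using hinge_midpoint_less[OF sg(1) that(1,2), of c] unfolding gap_def by linarith
    qed
    show ?case
    proof (rule ccontr)
      assume "W x \<noteq> T x"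
      then consider "x - W x < x - T x" | "x - T x < x - W x" by linarith
      then show False
        using Rats_dense_in_real *[of "x - W x" _ "x - T x"] *[of "x - T x" _ "x - W x"]
        by cases (metis insert_commute)+
    qed
  qed
  then show ?thesis
    using AE_restrict_measure[OF A'] by simp
qed

section \<open>Splitting at a point\<close>

lemma finite_borel_measureI:
  assumes "\<eta> \<in> \<M>"
  shows "finite_borel_measure \<eta>"
proof -
  note D = finite_first_moment_measuresD[OF assms]
  interpret finite_measure \<eta> by (rule D)
  show ?thesis by unfold_locales (use D in auto)
qed

text \<open>The difference of the payoffs is a - k up to k and 0 from a on. The closed half-line
  below and the open one above are what identifies the one-sided derivatives exactly, atoms
  included.\<close>

lemma put_fun_increment:
  assumes \<eta>: "\<eta> \<in> \<M>" and "k \<le> a"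
  shows "(a - k) * measure \<eta> {..k} \<le> put_fun \<eta> a - put_fun \<eta> k"
    "put_fun \<eta> a - put_fun \<eta> k \<le> (a - k) * measure \<eta> {..<a}"
proof -
  note D = finite_first_moment_measuresD[OF \<eta>]
  have diff: "put_fun \<eta> a - put_fun \<eta> k = (LINT x|\<eta>. max (a - x) 0 - max (k - x) 0)"
    unfolding put_fun_def using integrable_put_call(1)[OF D(3,4)] by simp
  have int: "integrable \<eta> (\<lambda>x. max (a - x) 0 - max (k - x) 0)"
    using integrable_put_call(1)[OF D(3,4)] by simp
  show "(a - k) * measure \<eta> {..k} \<le> put_fun \<eta> a - put_fun \<eta> k"
    unfolding diff integral_indicator_measure(1)[OF \<eta>, of "{..k}" "a - k", OF atMost_borel, symmetric]
    using \<open>k \<le> a\<close>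
    by (intro integral_mono int integral_indicator_measure(2)[OF \<eta>]) (auto simp: indicator_def)
  show "put_fun \<eta> a - put_fun \<eta> k \<le> (a - k) * measure \<eta> {..<a}"
    unfolding diff integral_indicator_measure(1)[OF \<eta>, of "{..<a}" "a - k", OF lessThan_borel, symmetric]
    using \<open>k \<le> a\<close>
    by (intro integral_mono int integral_indicator_measure(2)[OF \<eta>]) (auto simp: indicator_def)
qed

text \<open>The difference quotient is squeezed between the cdf at k and its left limit at a. The
  constant \<open>c\<close> covers \<open>put_fun\<close> and \<open>shifted_put\<close> at
  once.\<close>

lemma left_deriv_put_fun:
  assumes \<eta>: "\<eta> \<in> \<M>"
  shows "left_deriv (\<lambda>k. put_fun \<eta> k + c) a = measure \<eta> {..<a}"
proof -
  interpret finite_borel_measure \<eta> by (rule finite_borel_measureI[OF \<eta>])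
  have "((\<lambda>k. (put_fun \<eta> k + c - (put_fun \<eta> a + c)) / (k - a)) \<longlongrightarrow> measure \<eta> {..<a}) (at_left a)"
  proof (rule tendsto_sandwich[OF _ _ cdf_at_left tendsto_const])
    show "eventually (\<lambda>k. cdf \<eta> k \<le> (put_fun \<eta> k + c - (put_fun \<eta> a + c)) / (k - a)) (at_left a)"
      unfolding eventually_at_filter
      by (intro always_eventually allI impI)
         (use put_fun_increment(1)[OF \<eta>] in \<open>force simp: cdf_def divide_simps algebra_simps\<close>)
    show "eventually (\<lambda>k. (put_fun \<eta> k + c - (put_fun \<eta> a + c)) / (k - a) \<le> measure \<eta> {..<a}) (at_left a)"
      unfolding eventually_at_filter
      by (intro always_eventually allI impI)
         (use put_fun_increment(2)[OF \<eta>] in \<open>force simp: divide_simps algebra_simps\<close>)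
  qed
  then have "((\<lambda>k. put_fun \<eta> k + c) has_vector_derivative measure \<eta> {..<a}) (at_left a)"
    by (simp add: has_field_derivative_iff flip: has_real_derivative_iff_has_vector_derivative)
  then show ?thesis
    unfolding left_deriv_def by (rule vector_derivative_within[rotated]) simp
qed

lemma right_deriv_put_fun:
  assumes \<eta>: "\<eta> \<in> \<M>"
  shows "right_deriv (\<lambda>k. put_fun \<eta> k + c) a = measure \<eta> {..a}"
proof -
  interpret finite_borel_measure \<eta> by (rule finite_borel_measureI[OF \<eta>])
  have lim: "(cdf \<eta> \<longlongrightarrow> measure \<eta> {..a}) (at_right a)"
    using cdf_is_right_cont[of a] by (simp add: continuous_within cdf_def)
  have "((\<lambda>k. (put_fun \<eta> k + c - (put_fun \<eta> a + c)) / (k - a)) \<longlongrightarrow> measure \<eta> {..a}) (at_right a)"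
  proof (rule tendsto_sandwich[OF _ _ tendsto_const lim])
    show "eventually (\<lambda>k. measure \<eta> {..a} \<le> (put_fun \<eta> k + c - (put_fun \<eta> a + c)) / (k - a)) (at_right a)"
      unfolding eventually_at_filter
      by (intro always_eventually allI impI)
         (use put_fun_increment(1)[OF \<eta>] in \<open>force simp: divide_simps algebra_simps\<close>)
    have "(put_fun \<eta> k + c - (put_fun \<eta> a + c)) / (k - a) \<le> cdf \<eta> k" if "a < k" for k
    proof -
      have "put_fun \<eta> k - put_fun \<eta> a \<le> (k - a) * measure \<eta> {..<k}"
        using put_fun_increment(2)[OF \<eta>, of a k] that by simp
      also have "\<dots> \<le> (k - a) * cdf \<eta> k"
        unfolding cdf_def using that by (intro mult_left_mono finite_measure_mono) auto
      finally show ?thesis using that by (simp add: divide_simps algebra_simps)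
    qed
    then show "eventually (\<lambda>k. (put_fun \<eta> k + c - (put_fun \<eta> a + c)) / (k - a) \<le> cdf \<eta> k) (at_right a)"
      unfolding eventually_at_filter by (intro always_eventually) auto
  qed
  then have "((\<lambda>k. put_fun \<eta> k + c) has_vector_derivative measure \<eta> {..a}) (at_right a)"
    by (simp add: has_field_derivative_iff flip: has_real_derivative_iff_has_vector_derivative)
  then show ?thesis
    unfolding right_deriv_def by (rule vector_derivative_within[rotated]) simp
qed

text \<open>First-order conditions at a maximum of the difference of put functions. They make the
  weights of the atoms in \<open>chi_minus\<close> and \<open>chi_plus\<close> nonnegative, so that
  \<open>ennreal\<close> does not truncate them.\<close>

lemma measures_at_maximal_gap:
  assumes \<mu>: "\<mu> \<in> \<M>" and \<nu>: "\<nu> \<in> \<M>"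
    and max: "\<And>k. put_fun \<mu> k - put_fun \<nu> k \<le> put_fun \<mu> a - put_fun \<nu> a"
  shows "measure \<nu> {..<a} \<le> measure \<mu> {..<a}" "measure \<mu> {..a} \<le> measure \<nu> {..a}"
proof -
  interpret N: finite_borel_measure \<nu> by (rule finite_borel_measureI[OF \<nu>])
  have left: "cdf \<nu> k \<le> measure \<mu> {..<a}" if "k < a" for k
  proof -
    have "(a - k) * cdf \<nu> k \<le> (a - k) * measure \<mu> {..<a}"
      using put_fun_increment(1)[OF \<nu>, of k a] put_fun_increment(2)[OF \<mu>, of k a] max[of k] that
      unfolding cdf_def by linarith
    then show ?thesis using that by simp
  qed
  show "measure \<nu> {..<a} \<le> measure \<mu> {..<a}"
    by (rule tendsto_upperbound[OF N.cdf_at_left])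
       (auto simp: eventually_at_filter intro!: always_eventually left)
  have right: "measure \<mu> {..a} \<le> cdf \<nu> k" if "a < k" for k
  proof -
    have "(k - a) * measure \<mu> {..a} \<le> (k - a) * measure \<nu> {..<k}"
      using put_fun_increment(2)[OF \<nu>, of a k] put_fun_increment(1)[OF \<mu>, of a k] max[of k] that
      by linarith
    also have "\<dots> \<le> (k - a) * cdf \<nu> k"
      unfolding cdf_def using that by (intro mult_left_mono N.finite_measure_mono) auto
    finally show ?thesis using that by simp
  qed
  have lim: "(cdf \<nu> \<longlongrightarrow> measure \<nu> {..a}) (at_right a)"
    using N.cdf_is_right_cont[of a] by (simp add: continuous_within cdf_def)
  show "measure \<mu> {..a} \<le> measure \<nu> {..a}"
    by (rule tendsto_lowerbound[OF lim])
       (auto simp: eventually_at_filter intro!: always_eventually right)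
qed

section \<open>Restriction with an added atom\<close>

lemma nn_integral_add_dirac:
  assumes "sets \<eta> = sets borel" "f \<in> borel_measurable borel"
  shows "(\<integral>\<^sup>+ x. f x \<partial>add_dirac \<eta> w a) = (\<integral>\<^sup>+ x. f x \<partial>\<eta>) + ennreal w * f a"
  using assms(2)
proof (induction f rule: borel_measurable_induct)
  case (cong f g)
  then show ?case by (simp cong: nn_integral_cong)
next
  case (set A)
  then show ?case using assms(1) by (simp add: emeasure_add_dirac)
next
  case (mult u c)
  then have "u \<in> borel_measurable \<eta>" "u \<in> borel_measurable (add_dirac \<eta> w a)"
    using measurable_cong_sets[OF assms(1) refl] measurable_cong_sets[OF sets_add_dirac refl] by blast+
  then show ?case using mult by (simp add: nn_integral_cmult distrib_left ac_simps)
next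
  case (add u v)
  then have "u \<in> borel_measurable \<eta>" "u \<in> borel_measurable (add_dirac \<eta> w a)"
    "v \<in> borel_measurable \<eta>" "v \<in> borel_measurable (add_dirac \<eta> w a)"
    using measurable_cong_sets[OF assms(1) refl] measurable_cong_sets[OF sets_add_dirac refl] by blast+
  then show ?case using add by (simp add: nn_integral_add distrib_left ac_simps)
next
  case (seq U)
  then have m: "U i \<in> borel_measurable \<eta>" "U i \<in> borel_measurable (add_dirac \<eta> w a)" for i
    using measurable_cong_sets[OF assms(1) refl] measurable_cong_sets[OF sets_add_dirac refl] by blast+
  have inc: "incseq (\<lambda>i. \<integral>\<^sup>+ x. U i x \<partial>\<eta>)" "incseq (\<lambda>i. ennreal w * U i a)"
    using \<open>incseq U\<close> by (auto simp: incseq_def le_fun_def intro!: nn_integral_mono mult_left_mono)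
  have "(\<integral>\<^sup>+ x. (SUP i. U i x) \<partial>add_dirac \<eta> w a) = (SUP i. \<integral>\<^sup>+ x. U i x \<partial>add_dirac \<eta> w a)"
    by (rule nn_integral_monotone_convergence_SUP[OF \<open>incseq U\<close> m(2)])
  also have "\<dots> = (SUP i. (\<integral>\<^sup>+ x. U i x \<partial>\<eta>) + ennreal w * U i a)"
    using seq by simp
  also have "\<dots> = (SUP i. \<integral>\<^sup>+ x. U i x \<partial>\<eta>) + (SUP i. ennreal w * U i a)"
    by (rule ennreal_SUP_add[OF inc])
  also have "\<dots> = (\<integral>\<^sup>+ x. (SUP i. U i x) \<partial>\<eta>) + ennreal w * (SUP i. U i a)"
    by (simp add: nn_integral_monotone_convergence_SUP[OF \<open>incseq U\<close> m(1)] SUP_mult_left_ennreal)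
  finally show ?case by (simp add: image_comp SUP_apply)
qed

lemma integral_add_dirac:
  fixes f :: "real \<Rightarrow> real"
  assumes \<eta>: "sets \<eta> = sets borel" and f: "f \<in> borel_measurable borel" "integrable \<eta> f" and w: "0 \<le> w"
  shows "integrable (add_dirac \<eta> w a) f" "(LINT x|add_dirac \<eta> w a. f x) = (LINT x|\<eta>. f x) + w * f a"
proof -
  have fm: "f \<in> borel_measurable (add_dirac \<eta> w a)"
    using f(1) measurable_cong_sets[OF sets_add_dirac refl] by blast
  have fin: "(\<integral>\<^sup>+ x. ennreal (f x) \<partial>\<eta>) < \<infinity>" "(\<integral>\<^sup>+ x. ennreal (- f x) \<partial>\<eta>) < \<infinity>"
    using f(2) by (auto simp: real_integrable_def less_top)
  have nn: "(\<integral>\<^sup>+ x. ennreal (f x) \<partial>add_dirac \<eta> w a) = (\<integral>\<^sup>+ x. ennreal (f x) \<partial>\<eta>) + ennreal w * ennreal (f a)"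
    "(\<integral>\<^sup>+ x. ennreal (- f x) \<partial>add_dirac \<eta> w a) = (\<integral>\<^sup>+ x. ennreal (- f x) \<partial>\<eta>) + ennreal w * ennreal (- f a)"
    using f(1) by (auto intro!: nn_integral_add_dirac[OF \<eta>])
  show i: "integrable (add_dirac \<eta> w a) f"
    unfolding real_integrable_def nn using fm fin by (auto simp: ennreal_mult_eq_top_iff)
  show "(LINT x|add_dirac \<eta> w a. f x) = (LINT x|\<eta>. f x) + w * f a"
    unfolding real_lebesgue_integral_def[OF i] real_lebesgue_integral_def[OF f(2)] nn
    using fin w by (cases "0 \<le> f a") (simp_all add: enn2real_plus enn2real_mult ennreal_neg ennreal_mult_less_top algebra_simps)
qed

lemma restrict_add_dirac:
  fixes w a k :: real
  assumes \<nu>: "\<nu> \<in> \<M>" and A: "A \<in> sets borel" and w: "0 \<le> w"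
  defines "\<xi> \<equiv> add_dirac (restrict_measure \<nu> A) w a"
  shows "\<xi> \<in> \<M>" "measure \<xi> UNIV = measure \<nu> A + w"
    "(LINT x|\<xi>. x) = (LINT x|\<nu>. indicator A x * x) + w * a"
    "put_fun \<xi> k = (LINT x|\<nu>. indicator A x * max (k - x) 0) + w * max (k - a) 0"
    "call_fun \<xi> k = (LINT x|\<nu>. indicator A x * max (x - k) 0) + w * max (a - k) 0"
proof -
  note D = finite_first_moment_measuresD[OF \<nu>]
  note R = restrict_measure_finite_first_moment[OF \<nu> A]
  note E = finite_first_moment_measuresD[OF R(1)]
  have A': "A \<in> sets \<nu>" using A D by simp
  have fm: "f \<in> borel_measurable \<nu>" if "f \<in> borel_measurable borel" for f :: "real \<Rightarrow> real"
    using that measurable_cong_sets[OF D(1) refl] by blast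
  have e: "emeasure \<xi> UNIV = emeasure (restrict_measure \<nu> A) UNIV + ennreal w"
    unfolding \<xi>_def using E(1) by (simp add: emeasure_add_dirac)
  also have "\<dots> = ennreal (measure \<nu> A + w)"
    using w finite_measure.emeasure_eq_measure[OF E(3)] R(2) by simp
  finally have e: "emeasure \<xi> UNIV = ennreal (measure \<nu> A + w)" .
  have s: "sets \<xi> = sets borel" by (simp add: \<xi>_def)
  have fin: "finite_measure \<xi>"
    using e sets_eq_imp_space_eq[OF s] by (intro finite_measureI) simp
  show "measure \<xi> UNIV = measure \<nu> A + w"
    unfolding measure_def[of \<xi>] e using w by (simp del: ennreal_plus)
  have "integrable \<xi> (\<lambda>x. x)"
    unfolding \<xi>_def by (rule integral_add_dirac(1)[OF E(1) _ E(4) w]) simp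
  then show "\<xi> \<in> \<M>" by (rule finite_first_moment_measuresI[OF s fin])
  have int: "(LINT x|\<xi>. f x) = (LINT x|\<nu>. indicator A x * f x) + w * f a"
    if "f \<in> borel_measurable borel" "integrable (restrict_measure \<nu> A) f" for f :: "real \<Rightarrow> real"
    unfolding \<xi>_def using integral_add_dirac(2)[OF E(1) that w]
      integral_restrict_measure(1)[OF A' fm[OF that(1)]] by simp
  show "(LINT x|\<xi>. x) = (LINT x|\<nu>. indicator A x * x) + w * a"
    by (rule int[OF _ E(4)]) simp
  show "put_fun \<xi> k = (LINT x|\<nu>. indicator A x * max (k - x) 0) + w * max (k - a) 0"
    unfolding put_fun_def by (rule int) (use integrable_put_call[OF E(3,4)] in auto)
  show "call_fun \<xi> k = (LINT x|\<nu>. indicator A x * max (x - k) 0) + w * max (a - k) 0"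
    unfolding call_fun_def by (rule int) (use integrable_put_call[OF E(3,4)] in auto)
qed

lemma put_fun_eq_call_fun:
  assumes "\<eta> \<in> \<M>"
  shows "put_fun \<eta> k = call_fun \<eta> k + k * measure \<eta> UNIV - (LINT x|\<eta>. x)"
  using put_call_parity[OF finite_first_moment_measuresD(3,4)[OF assms], of k]
    finite_first_moment_measuresD(2)[OF assms]
  by (simp add: put_fun_def call_fun_def)

lemma put_fun_nonneg: "0 \<le> put_fun \<eta> k" and call_fun_nonneg: "0 \<le> call_fun \<eta> k"
  unfolding put_fun_def call_fun_def by (auto intro!: Bochner_Integration.integral_nonneg)

lemma measurable_finite_first_moment:
  assumes "\<eta> \<in> \<M>" "f \<in> borel_measurable borel"
  shows "f \<in> borel_measurable \<eta>"
  using assms(2) measurable_cong_sets[OF finite_first_moment_measuresD(1)[OF assms(1)] refl] by blast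

section \<open>Splitting a map that moves no mass across a point\<close>

lemma dominated_map_restrictI:
  assumes \<mu>: "\<mu> \<in> \<M>" and A: "A \<in> sets borel" and W: "W \<in> borel_measurable borel" "integrable \<mu> W"
    and "measure \<mu> A = measure \<xi> UNIV" "(LINT x|\<mu>. indicator A x * W x) = (LINT x|\<xi>. x)"
    and "\<And>k. (LINT x|\<mu>. indicator A x * max (k - W x) 0) \<le> put_fun \<xi> k"
  shows "dominated_map (restrict_measure \<mu> A) \<xi> W"
proof -
  note D = finite_first_moment_measuresD[OF \<mu>]
  have A': "A \<in> sets \<mu>" using A D by simp
  note m = measurable_finite_first_moment[OF \<mu>]
  note R = integral_restrict_measure[OF A' m]
  have "integrable (restrict_measure \<mu> A) W"
    using R(2)[OF W(1)] integrable_mult_indicator[OF A' W(2)] by simp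
  moreover have "(LINT x|restrict_measure \<mu> A. max (k - W x) 0) \<le> put_fun \<xi> k" for k
    using R(1)[of "\<lambda>x. max (k - W x) 0"] assms W by simp
  ultimately show ?thesis
    using assms R(1)[OF W(1)] restrict_measure_finite_first_moment(2)[OF \<mu> A]
    by (simp add: dominated_map_def)
qed

text \<open>Up to \<open>a\<close> the put functions of \<xi> and \<nu> coincide and the points from
  \<open>a\<close> on contribute nothing. Beyond \<open>a\<close> the put function of \<xi> is
  affine, starting from \<open>put_fun \<nu> a\<close> with slope
  \<open>measure \<mu> {..<a}\<close>, and by \<open>eq\<close> the same holds for the image of the
  restricted measure. So both inequalities reduce to the domination of W by \<nu> or to an equality.
  The last conclusion is the hypothesis \<open>put\<close> of
  \<open>optimal_map_eq_on\<close>.\<close>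

lemma lower_split:
  assumes \<mu>: "\<mu> \<in> \<M>" and \<nu>: "\<nu> \<in> \<M>" and W: "dominated_map \<mu> \<nu> W"
    and le: "AE x in \<mu>. (x < a \<longrightarrow> W x \<le> a) \<and> (a \<le> x \<longrightarrow> a \<le> W x)"
    and eq: "(LINT x|\<mu>. max (a - W x) 0) = put_fun \<nu> a"
    and w: "0 \<le> w" "w = measure \<mu> {..<a} - measure \<nu> {..<a}"
  defines "\<xi> \<equiv> add_dirac (restrict_measure \<nu> {..<a}) w a"
  shows "\<xi> \<in> \<M>" "dominated_map (restrict_measure \<mu> {..<a}) \<xi> W"
    "put_fun \<xi> k + (LINT x|\<mu>. indicator (- {..<a}) x * max (k - W x) 0) \<le> put_fun \<nu> k"
proof -
  let ?A = "{..<a}"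
  note D = finite_first_moment_measuresD[OF \<mu>] and E = finite_first_moment_measuresD[OF \<nu>]
  note \<xi> = restrict_add_dirac[OF \<nu> _ w(1), of ?A a, folded \<xi>_def, OF lessThan_borel]
  show "\<xi> \<in> \<M>" by (rule \<xi>)
  have W': "W \<in> borel_measurable borel" "integrable \<mu> W"
    using W by (auto simp: dominated_map_def)
  have m: "(\<lambda>x. indicator B x * f x) \<in> borel_measurable \<mu>" if "B \<in> sets borel" "f \<in> borel_measurable borel"
    for B and f :: "real \<Rightarrow> real"
    using that
    by (intro measurable_finite_first_moment[OF \<mu>] borel_measurable_times borel_measurable_indicator)
  have i: "integrable \<mu> (\<lambda>x. indicator B x * f x)" if "B \<in> sets borel" "integrable \<mu> f"
    for B and f :: "real \<Rightarrow> real"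
    using integrable_mult_indicator[of B \<mu> f] that D by simp
  have i': "integrable \<nu> (\<lambda>x. indicator B x * f x)" if "B \<in> sets borel" "integrable \<nu> f"
    for B and f :: "real \<Rightarrow> real"
    using integrable_mult_indicator[of B \<nu> f] that E by simp
  note iW = integrable_put_call(1)[OF D(3) W'(2)]
  have put_below: "put_fun \<xi> k = put_fun \<nu> k" if "k \<le> a" for k
    unfolding \<xi>(4) put_fun_def[of \<nu>] using that
    by (auto intro!: Bochner_Integration.integral_cong simp: indicator_def)
  have mass: "measure \<xi> UNIV = measure \<mu> ?A"
    using \<xi>(2) w by simp
  have put_\<nu>: "(LINT x|\<nu>. indicator ?A x * (k - x)) = put_fun \<nu> a + (k - a) * measure \<nu> ?A" for k
  proof -
    have "(LINT x|\<nu>. indicator ?A x * (k - x)) = (LINT x|\<nu>. max (a - x) 0 + indicator ?A x * (k - a))"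
      by (intro Bochner_Integration.integral_cong) (auto simp: indicator_def)
    then show ?thesis
      using integral_indicator_measure[OF \<nu>, of ?A "k - a"] integrable_put_call(1)[OF E(3,4)]
      by (simp add: put_fun_def)
  qed
  have put_above: "put_fun \<xi> k = put_fun \<nu> a + (k - a) * measure \<mu> ?A" if "a \<le> k" for k
  proof -
    have "put_fun \<xi> k = (LINT x|\<nu>. indicator ?A x * (k - x)) + w * (k - a)"
      unfolding \<xi>(4) using that
      by (auto intro!: Bochner_Integration.integral_cong simp: indicator_def)
    then show ?thesis unfolding put_\<nu> w(2) by (simp add: algebra_simps)
  qed
  have mean: "(LINT x|\<xi>. x) = a * measure \<mu> ?A - put_fun \<nu> a"
    unfolding \<xi>(3) w(2) using put_\<nu>[of 0] by (simp add: algebra_simps)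
  have W_int: "(LINT x|\<mu>. indicator ?A x * (k - W x)) = put_fun \<nu> a + (k - a) * measure \<mu> ?A" for k
  proof -
    have "(LINT x|\<mu>. indicator ?A x * (k - W x)) = (LINT x|\<mu>. max (a - W x) 0 + indicator ?A x * (k - a))"
    proof (rule integral_cong_AE)
      show "AE x in \<mu>. indicator ?A x * (k - W x) = max (a - W x) 0 + indicator ?A x * (k - a)"
        using le by eventually_elim (auto simp: indicator_def)
      show "(\<lambda>x. max (a - W x) 0 + indicator ?A x * (k - a)) \<in> borel_measurable \<mu>"
        using W' by (intro measurable_finite_first_moment[OF \<mu>] borel_measurable_add
            borel_measurable_times borel_measurable_indicator) simp_all
    qed (use W' in \<open>auto intro!: m\<close>)
    then show ?thesis
      using integral_indicator_measure[OF \<mu>, of ?A "k - a"] iW eq by simp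
  qed
  have below: "(LINT x|\<mu>. indicator (- ?A) x * max (k - W x) 0) = 0" if "k \<le> a" for k
  proof (rule integral_eq_zero_AE)
    show "AE x in \<mu>. indicator (- ?A) x * max (k - W x) 0 = 0"
      using le by eventually_elim (use that in \<open>auto simp: indicator_def\<close>)
  qed
  have split: "(LINT x|\<mu>. max (k - W x) 0) =
      (LINT x|\<mu>. indicator ?A x * max (k - W x) 0) + (LINT x|\<mu>. indicator (- ?A) x * max (k - W x) 0)" for k
  proof -
    have "(LINT x|\<mu>. max (k - W x) 0) =
        (LINT x|\<mu>. indicator ?A x * max (k - W x) 0 + indicator (- ?A) x * max (k - W x) 0)"
      by (intro Bochner_Integration.integral_cong) (auto simp: indicator_def)
    then show ?thesis using i[OF _ iW] by simp
  qed
  have W_above: "(LINT x|\<mu>. indicator ?A x * max (k - W x) 0) = put_fun \<xi> k" if "a \<le> k" for k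
  proof -
    have "(LINT x|\<mu>. indicator ?A x * max (k - W x) 0) = (LINT x|\<mu>. indicator ?A x * (k - W x))"
    proof (rule integral_cong_AE)
      show "AE x in \<mu>. indicator ?A x * max (k - W x) 0 = indicator ?A x * (k - W x)"
        using le by eventually_elim (use that in \<open>auto simp: indicator_def\<close>)
    qed (use W' in \<open>auto intro!: m\<close>)
    then show ?thesis using W_int put_above[OF that] by simp
  qed
  have dom: "(LINT x|\<mu>. max (k - W x) 0) \<le> put_fun \<nu> k" for k
    using W by (simp add: dominated_map_def)
  show "put_fun \<xi> k + (LINT x|\<mu>. indicator (- {..<a}) x * max (k - W x) 0) \<le> put_fun \<nu> k" for k
    using put_below[of k] below[of k] W_above[of k] split[of k] dom[of k] by (cases "k \<le> a") auto
  show "dominated_map (restrict_measure \<mu> {..<a}) \<xi> W"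
  proof (rule dominated_map_restrictI[OF \<mu> lessThan_borel W'])
    show "measure \<mu> ?A = measure \<xi> UNIV" by (rule mass[symmetric])
    have "(LINT x|\<mu>. indicator ?A x * W x) = - (LINT x|\<mu>. indicator ?A x * (0 - W x))"
      by simp
    then show "(LINT x|\<mu>. indicator ?A x * W x) = (LINT x|\<xi>. x)"
      unfolding W_int mean by simp
    show "(LINT x|\<mu>. indicator ?A x * max (k - W x) 0) \<le> put_fun \<xi> k" for k
      using put_below[of k] below[of k] W_above[of k] split[of k] dom[of k] by (cases "k \<le> a") auto
  qed
qed

text \<open>The mirror image of \<open>lower_split\<close>, argued with call functions. Parity
  translates \<open>eq\<close> into call functions and the results back into put functions; it
  applies because masses and means agree.\<close>

lemma upper_split:
  assumes \<mu>: "\<mu> \<in> \<M>" and \<nu>: "\<nu> \<in> \<M>" and W: "dominated_map \<mu> \<nu> W"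
    and le: "AE x in \<mu>. (a < x \<longrightarrow> a \<le> W x) \<and> (x \<le> a \<longrightarrow> W x \<le> a)"
    and eq: "(LINT x|\<mu>. max (a - W x) 0) = put_fun \<nu> a"
    and w: "0 \<le> w" "w = measure \<mu> {a<..} - measure \<nu> {a<..}"
  defines "\<xi> \<equiv> add_dirac (restrict_measure \<nu> {a<..}) w a"
  shows "\<xi> \<in> \<M>" "dominated_map (restrict_measure \<mu> {a<..}) \<xi> W"
    "put_fun \<xi> k + (LINT x|\<mu>. indicator (- {a<..}) x * max (k - W x) 0) \<le> put_fun \<nu> k"
proof -
  let ?A = "{a<..}"
  note D = finite_first_moment_measuresD[OF \<mu>] and E = finite_first_moment_measuresD[OF \<nu>]
  note \<xi> = restrict_add_dirac[OF \<nu> _ w(1), of ?A a, folded \<xi>_def, OF greaterThan_borel]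
  show \<xi>M: "\<xi> \<in> \<M>" by (rule \<xi>)
  have W': "W \<in> borel_measurable borel" "integrable \<mu> W"
    using W by (auto simp: dominated_map_def)
  have m: "(\<lambda>x. indicator B x * f x) \<in> borel_measurable \<mu>" if "B \<in> sets borel" "f \<in> borel_measurable borel"
    for B and f :: "real \<Rightarrow> real"
    using that
    by (intro measurable_finite_first_moment[OF \<mu>] borel_measurable_times borel_measurable_indicator)
  have i: "integrable \<mu> (\<lambda>x. indicator B x * f x)" if "B \<in> sets borel" "integrable \<mu> f"
    for B and f :: "real \<Rightarrow> real"
    using integrable_mult_indicator[of B \<mu> f] that D by simp
  note iW = integrable_put_call[OF D(3) W'(2)]
  have parity: "(LINT x|\<mu>. max (k - W x) 0) =
      (LINT x|\<mu>. max (W x - k) 0) + k * measure \<nu> UNIV - (LINT x|\<nu>. x)" for k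
    using put_call_parity[OF D(3) W'(2), of k] W D(2) by (simp add: dominated_map_def)
  have eq': "(LINT x|\<mu>. max (W x - a) 0) = call_fun \<nu> a"
    using parity[of a] eq put_fun_eq_call_fun[OF \<nu>, of a] by simp
  have call_above: "call_fun \<xi> k = call_fun \<nu> k" if "a \<le> k" for k
    unfolding \<xi>(5) call_fun_def[of \<nu>] using that
    by (auto intro!: Bochner_Integration.integral_cong simp: indicator_def)
  have mass: "measure \<xi> UNIV = measure \<mu> ?A"
    using \<xi>(2) w by simp
  have call_\<nu>: "(LINT x|\<nu>. indicator ?A x * (x - k)) = call_fun \<nu> a + (a - k) * measure \<nu> ?A" for k
  proof -
    have "(LINT x|\<nu>. indicator ?A x * (x - k)) = (LINT x|\<nu>. max (x - a) 0 + indicator ?A x * (a - k))"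
      by (intro Bochner_Integration.integral_cong) (auto simp: indicator_def)
    then show ?thesis
      using integral_indicator_measure[OF \<nu>, of ?A "a - k"] integrable_put_call(2)[OF E(3,4)]
      by (simp add: call_fun_def)
  qed
  have call_below: "call_fun \<xi> k = call_fun \<nu> a + (a - k) * measure \<mu> ?A" if "k \<le> a" for k
  proof -
    have "call_fun \<xi> k = (LINT x|\<nu>. indicator ?A x * (x - k)) + w * (a - k)"
      unfolding \<xi>(5) using that
      by (auto intro!: Bochner_Integration.integral_cong simp: indicator_def)
    then show ?thesis unfolding call_\<nu> w(2) by (simp add: algebra_simps)
  qed
  have mean: "(LINT x|\<xi>. x) = a * measure \<mu> ?A + call_fun \<nu> a"
    unfolding \<xi>(3) w(2) using call_\<nu>[of 0] by (simp add: algebra_simps)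
  have W_int: "(LINT x|\<mu>. indicator ?A x * (W x - k)) = call_fun \<nu> a + (a - k) * measure \<mu> ?A" for k
  proof -
    have "(LINT x|\<mu>. indicator ?A x * (W x - k)) = (LINT x|\<mu>. max (W x - a) 0 + indicator ?A x * (a - k))"
    proof (rule integral_cong_AE)
      show "AE x in \<mu>. indicator ?A x * (W x - k) = max (W x - a) 0 + indicator ?A x * (a - k)"
        using le by eventually_elim (auto simp: indicator_def)
      show "(\<lambda>x. max (W x - a) 0 + indicator ?A x * (a - k)) \<in> borel_measurable \<mu>"
        using W' by (intro measurable_finite_first_moment[OF \<mu>] borel_measurable_add
            borel_measurable_times borel_measurable_indicator) simp_all
    qed (use W' in \<open>auto intro!: m\<close>)
    then show ?thesis
      using integral_indicator_measure[OF \<mu>, of ?A "a - k"] iW eq' by simp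
  qed
  have W_mean: "(LINT x|\<mu>. indicator ?A x * W x) = (LINT x|\<xi>. x)"
    using W_int[of 0] mean by simp
  have above: "(LINT x|\<mu>. indicator (- ?A) x * max (W x - k) 0) = 0" if "a \<le> k" for k
  proof (rule integral_eq_zero_AE)
    show "AE x in \<mu>. indicator (- ?A) x * max (W x - k) 0 = 0"
      using le by eventually_elim (use that in \<open>auto simp: indicator_def\<close>)
  qed
  have split: "(LINT x|\<mu>. max (W x - k) 0) =
      (LINT x|\<mu>. indicator ?A x * max (W x - k) 0) + (LINT x|\<mu>. indicator (- ?A) x * max (W x - k) 0)" for k
  proof -
    have "(LINT x|\<mu>. max (W x - k) 0) =
        (LINT x|\<mu>. indicator ?A x * max (W x - k) 0 + indicator (- ?A) x * max (W x - k) 0)"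
      by (intro Bochner_Integration.integral_cong) (auto simp: indicator_def)
    then show ?thesis using i[OF _ iW(2)] by simp
  qed
  have W_below: "(LINT x|\<mu>. indicator ?A x * max (W x - k) 0) = call_fun \<xi> k" if "k \<le> a" for k
  proof -
    have "(LINT x|\<mu>. indicator ?A x * max (W x - k) 0) = (LINT x|\<mu>. indicator ?A x * (W x - k))"
    proof (rule integral_cong_AE)
      show "AE x in \<mu>. indicator ?A x * max (W x - k) 0 = indicator ?A x * (W x - k)"
        using le by eventually_elim (use that in \<open>auto simp: indicator_def\<close>)
    qed (use W' in \<open>auto intro!: m\<close>)
    then show ?thesis using W_int call_below[OF that] by simp
  qed
  have dom: "(LINT x|\<mu>. max (W x - k) 0) \<le> call_fun \<nu> k" for k
    using W parity[of k] put_fun_eq_call_fun[OF \<nu>, of k] by (auto simp: dominated_map_def dest!: spec[of _ k])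
  \<comment> \<open>Parity on the restricted part, with its mass and mean already replaced by those
    of \<xi>.\<close>
  have A_parity: "(LINT x|\<mu>. indicator ?A x * max (k - W x) 0) =
      (LINT x|\<mu>. indicator ?A x * max (W x - k) 0) + k * measure \<xi> UNIV - (LINT x|\<xi>. x)" for k
  proof -
    have "(LINT x|\<mu>. indicator ?A x * max (k - W x) 0) =
        (LINT x|\<mu>. indicator ?A x * max (W x - k) 0 + indicator ?A x * k - indicator ?A x * W x)"
      by (intro Bochner_Integration.integral_cong) (auto simp: indicator_def max_def)
    then show ?thesis
      using i[OF _ iW(2)] i[OF _ W'(2)] integral_indicator_measure[OF \<mu>, of ?A k] W_mean mass by simp
  qed
  have put_split: "(LINT x|\<mu>. max (k - W x) 0) =
      (LINT x|\<mu>. indicator ?A x * max (k - W x) 0) + (LINT x|\<mu>. indicator (- ?A) x * max (k - W x) 0)" for k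
  proof -
    have "(LINT x|\<mu>. max (k - W x) 0) =
        (LINT x|\<mu>. indicator ?A x * max (k - W x) 0 + indicator (- ?A) x * max (k - W x) 0)"
      by (intro Bochner_Integration.integral_cong) (auto simp: indicator_def)
    then show ?thesis using i[OF _ iW(1)] by simp
  qed
  note parities = A_parity parity put_fun_eq_call_fun[OF \<nu>] put_fun_eq_call_fun[OF \<xi>M]
  show "put_fun \<xi> k + (LINT x|\<mu>. indicator (- {a<..}) x * max (k - W x) 0) \<le> put_fun \<nu> k" for k
    using call_above[of k] above[of k] W_below[of k] split[of k] dom[of k] put_split[of k] parities[of k]
    by (cases "k \<le> a") auto
  show "dominated_map (restrict_measure \<mu> {a<..}) \<xi> W"
  proof (rule dominated_map_restrictI[OF \<mu> greaterThan_borel W' mass[symmetric] W_mean])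
    show "(LINT x|\<mu>. indicator ?A x * max (k - W x) 0) \<le> put_fun \<xi> k" for k
      using call_above[of k] above[of k] W_below[of k] split[of k] dom[of k] parities[of k]
      by (cases "k \<le> a") auto
  qed
qed

section \<open>Points of maximal gap\<close>

lemma continuous_put_fun:
  assumes \<eta>: "\<eta> \<in> \<M>"
  shows "continuous_on UNIV (put_fun \<eta>)"
proof -
  interpret finite_borel_measure \<eta> by (rule finite_borel_measureI[OF \<eta>])
  have le: "\<bar>put_fun \<eta> a - put_fun \<eta> k\<bar> \<le> measure \<eta> UNIV * \<bar>a - k\<bar>" if "k \<le> a" for a k
  proof -
    have "0 \<le> put_fun \<eta> a - put_fun \<eta> k"
      using that by (intro order_trans[OF _ put_fun_increment(1)[OF \<eta> that]]) simp
    moreover have "put_fun \<eta> a - put_fun \<eta> k \<le> (a - k) * measure \<eta> UNIV"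
      using that bounded_measure borel_UNIV
      by (intro order_trans[OF put_fun_increment(2)[OF \<eta> that]] mult_left_mono) simp_all
    ultimately show ?thesis
      using that by (simp add: mult.commute)
  qed
  have "(measure \<eta> UNIV)-lipschitz_on UNIV (put_fun \<eta>)"
  proof (rule lipschitz_onI)
    fix x y
    show "dist (put_fun \<eta> x) (put_fun \<eta> y) \<le> measure \<eta> UNIV * dist x y"
      using le[of x y] le[of y x] by (cases "x \<le> y") (auto simp: dist_real_def abs_minus_commute)
  qed simp
  then show ?thesis by (rule lipschitz_on_continuous_on)
qed

lemma continuous_call_fun:
  assumes "\<eta> \<in> \<M>"
  shows "continuous_on UNIV (call_fun \<eta>)"
proof -
  have "call_fun \<eta> = (\<lambda>k. put_fun \<eta> k - k * measure \<eta> UNIV + (LINT x|\<eta>. x))"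
    using put_fun_eq_call_fun[OF assms] by auto
  then show ?thesis
    using continuous_put_fun[OF assms] by (auto intro!: continuous_intros)
qed

lemma call_fun_at_top:
  assumes \<eta>: "\<eta> \<in> \<M>"
  shows "(call_fun \<eta> \<longlongrightarrow> 0) at_top"
proof -
  note D = finite_first_moment_measuresD[OF \<eta>]
  have "((\<lambda>k. LINT x|\<eta>. max (x - k) 0) \<longlongrightarrow> (LINT x|\<eta>. 0)) at_top"
  proof (rule integral_dominated_convergence_at_top[where w = "\<lambda>x. \<bar>x\<bar>"])
    have "((\<lambda>k. max (x - k) 0) \<longlongrightarrow> 0) at_top" for x :: real
      by (rule tendsto_eventually) (auto intro!: eventually_at_top_linorderI[of x])
    then show "AE x in \<eta>. ((\<lambda>k. max (x - k) 0) \<longlongrightarrow> 0) at_top" by simp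
    show "eventually (\<lambda>k. AE x in \<eta>. norm (max (x - k) 0) \<le> \<bar>x\<bar>) at_top"
      by (rule eventually_at_top_linorderI[of 0]) auto
    show "(\<lambda>x. max (x - k) 0) \<in> borel_measurable \<eta>" for k
      by (intro measurable_finite_first_moment[OF \<eta>]) simp
    show "integrable \<eta> (\<lambda>x. \<bar>x\<bar>)"
      using D(4) by simp
  qed simp
  then show ?thesis by (simp add: call_fun_def[abs_def])
qed

lemma put_fun_at_bot:
  assumes \<eta>: "\<eta> \<in> \<M>"
  shows "(put_fun \<eta> \<longlongrightarrow> 0) at_bot"
proof -
  note D = finite_first_moment_measuresD[OF \<eta>]
  have "((\<lambda>k. LINT x|\<eta>. max (- k - x) 0) \<longlongrightarrow> (LINT x|\<eta>. 0)) at_top"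
  proof (rule integral_dominated_convergence_at_top[where w = "\<lambda>x. \<bar>x\<bar>"])
    have "((\<lambda>k. max (- k - x) 0) \<longlongrightarrow> 0) at_top" for x :: real
      by (rule tendsto_eventually) (auto intro!: eventually_at_top_linorderI[of "- x"])
    then show "AE x in \<eta>. ((\<lambda>k. max (- k - x) 0) \<longlongrightarrow> 0) at_top" by simp
    show "eventually (\<lambda>k. AE x in \<eta>. norm (max (- k - x) 0) \<le> \<bar>x\<bar>) at_top"
      by (rule eventually_at_top_linorderI[of 0]) auto
    show "(\<lambda>x. max (- k - x) 0) \<in> borel_measurable \<eta>" for k
      by (intro measurable_finite_first_moment[OF \<eta>]) simp
    show "integrable \<eta> (\<lambda>x. \<bar>x\<bar>)"
      using D(4) by simp
  qed simp
  then show ?thesis by (simp add: put_fun_def[abs_def] filterlim_at_bot_mirror)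
qed

lemma bounded_range_of_limits:
  fixes f :: "real \<Rightarrow> real"
  assumes "continuous_on UNIV f" "(f \<longlongrightarrow> l1) at_bot" "(f \<longlongrightarrow> l2) at_top"
  shows "bdd_above (range f)"
proof -
  have "eventually (\<lambda>k. f k < l1 + 1) at_bot" "eventually (\<lambda>k. f k < l2 + 1) at_top"
    using order_tendstoD(2)[OF assms(2)] order_tendstoD(2)[OF assms(3)] by auto
  then obtain K1 K2 where K: "\<And>k. k \<le> K1 \<Longrightarrow> f k < l1 + 1" "\<And>k. K2 \<le> k \<Longrightarrow> f k < l2 + 1"
    by (auto simp: eventually_at_bot_linorder eventually_at_top_linorder)
  have "compact (f ` {K1..K2})"
    by (intro compact_continuous_image continuous_on_subset[OF assms(1)]) auto
  then obtain B where "\<And>k. k \<in> {K1..K2} \<Longrightarrow> f k \<le> B"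
    using compact_imp_bounded bounded_imp_bdd_above by (fastforce simp: bdd_above_def)
  then have "f k \<le> max B (max (l1 + 1) (l2 + 1))" for k
    using K(1)[of k] K(2)[of k] by (cases "k \<le> K1"; cases "K2 \<le> k") (auto simp: le_max_iff_disj)
  then show ?thesis by (auto simp: bdd_above_def)
qed

text \<open>A level strictly between both limits and the supremum confines the maximisers to a
  compact interval. They form a nonempty closed bounded set, which contains its infimum and
  supremum.\<close>

lemma sup_attained_between_limits:
  fixes f :: "real \<Rightarrow> real"
  assumes cont: "continuous_on UNIV f" and lim: "(f \<longlongrightarrow> l1) at_bot" "(f \<longlongrightarrow> l2) at_top"
    and less: "l1 < (SUP k. f k)" "l2 < (SUP k. f k)"
  defines "S \<equiv> {k. f k = (SUP k. f k)}"
  shows "f (Inf S) = (SUP k. f k)" "f (Sup S) = (SUP k. f k)" "Inf S \<le> Sup S"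
proof -
  let ?p = "SUP k. f k"
  have bdd: "bdd_above (range f)" by (rule bounded_range_of_limits[OF cont lim])
  define r where "r = (max l1 l2 + ?p) / 2"
  have r: "l1 < r" "l2 < r" "r < ?p"
    using less by (auto simp: r_def max_def)
  then have "eventually (\<lambda>k. f k < r) at_bot" "eventually (\<lambda>k. f k < r) at_top"
    using order_tendstoD(2)[OF lim(1)] order_tendstoD(2)[OF lim(2)] by auto
  then obtain K1 K2 where K: "\<And>k. k \<le> K1 \<Longrightarrow> f k < r" "\<And>k. K2 \<le> k \<Longrightarrow> f k < r"
    by (auto simp: eventually_at_bot_linorder eventually_at_top_linorder)
  have inside: "k \<in> {K1..K2}" if "r < f k" for k
    using K(1)[of k] K(2)[of k] that by force
  obtain k0 where k0: "r < f k0"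
    using less_cSUP_iff[OF _ bdd] r(3) by auto
  obtain m where m: "m \<in> {K1..K2}" "\<And>k. k \<in> {K1..K2} \<Longrightarrow> f k \<le> f m"
    using continuous_attains_sup[of "{K1..K2}" f] inside[OF k0] continuous_on_subset[OF cont] by auto
  have "f k \<le> f m" for k
  proof (cases "k \<in> {K1..K2}")
    case False
    then have "f k \<le> r" using inside[of k] by force
    with k0 m(2)[OF inside[OF k0]] show ?thesis by simp
  qed (rule m(2))
  then have "?p = f m"
    using bdd by (intro antisym cSUP_least cSUP_upper) auto
  then have ne: "S \<noteq> {}" by (auto simp: S_def)
  have sub: "S \<subseteq> {K1..K2}"
    using inside r(3) by (auto simp: S_def)
  have "S = f -` {?p}" by (auto simp: S_def)
  then have cl: "closed S"
    using continuous_closed_vimage[of "{?p}" f] cont by (simp add: continuous_on_eq_continuous_at)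
  have bd: "bdd_below S" "bdd_above S"
    using bdd_below_mono[OF _ sub] bdd_above_mono[OF _ sub] by auto
  show "f (Inf S) = ?p" "f (Sup S) = ?p"
    using closed_contains_Inf[OF ne bd(1) cl] closed_contains_Sup[OF ne bd(2) cl] by (auto simp: S_def)
  show "Inf S \<le> Sup S"
    by (rule cInf_le_cSup[OF ne bd(2,1)])
qed

text \<open>By parity the difference of the put functions is that of the call functions plus the
  difference e of the means, so it tends to 0 at -\<infinity> and to e at \<infinity>. The two
  positivity assumptions say that the supremum exceeds both limits.\<close>

lemma gap_attained:
  assumes \<mu>: "\<mu> \<in> \<M>" and \<nu>: "\<nu> \<in> \<M>" and mass: "measure \<mu> UNIV = measure \<nu> UNIV"
    and pos: "0 < p_gap \<mu> \<nu>" "0 < c_gap \<mu> \<nu>"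
  shows "put_fun \<mu> k - put_fun \<nu> k \<le> p_gap \<mu> \<nu>"
    "put_fun \<mu> (x_minus \<mu> \<nu>) - put_fun \<nu> (x_minus \<mu> \<nu>) = p_gap \<mu> \<nu>"
    "put_fun \<mu> (x_plus \<mu> \<nu>) - put_fun \<nu> (x_plus \<mu> \<nu>) = p_gap \<mu> \<nu>"
    "x_minus \<mu> \<nu> \<le> x_plus \<mu> \<nu>"
    "(LINT x|\<nu>. x) - (LINT x|\<mu>. x) < p_gap \<mu> \<nu>"
proof -
  define D where "D k = put_fun \<mu> k - put_fun \<nu> k" for k
  define e where "e = (LINT x|\<nu>. x) - (LINT x|\<mu>. x)"
  have D_call: "D k = call_fun \<mu> k - call_fun \<nu> k + e" for k
    using put_fun_eq_call_fun[OF \<mu>, of k] put_fun_eq_call_fun[OF \<nu>, of k] mass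
    by (simp add: D_def e_def)
  have cont: "continuous_on UNIV D"
    unfolding D_def[abs_def] by (intro continuous_on_diff continuous_put_fun \<mu> \<nu>)
  have lim: "(D \<longlongrightarrow> 0) at_bot" "(D \<longlongrightarrow> e) at_top"
  proof -
    show "(D \<longlongrightarrow> 0) at_bot"
      using tendsto_diff[OF put_fun_at_bot[OF \<mu>] put_fun_at_bot[OF \<nu>]] by (simp add: D_def[abs_def])
    have "((\<lambda>k. call_fun \<mu> k - call_fun \<nu> k + e) \<longlongrightarrow> 0 - 0 + e) at_top"
      by (intro tendsto_intros call_fun_at_top \<mu> \<nu>)
    then show "(D \<longlongrightarrow> e) at_top"
      using D_call by (simp add: D_def[abs_def])
  qed
  have bdd: "bdd_above (range D)" by (rule bounded_range_of_limits[OF cont lim])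
  have p: "p_gap \<mu> \<nu> = (SUP k. D k)" by (simp add: p_gap_def D_def)
  show le: "put_fun \<mu> k - put_fun \<nu> k \<le> p_gap \<mu> \<nu>" for k
    unfolding p D_def[symmetric] by (intro cSUP_upper bdd) auto
  obtain k where "0 < call_fun \<mu> k - call_fun \<nu> k"
  proof -
    have eq: "(\<lambda>k. call_fun \<mu> k - call_fun \<nu> k) = (\<lambda>k. D k - e)"
      using D_call by auto
    have "bdd_above (range (\<lambda>k. D k - e))"
      by (rule bdd_aboveI2[of _ _ "(SUP k. D k) - e"]) (simp add: cSUP_upper[OF _ bdd])
    then have "\<exists>k. 0 < D k - e"
      using pos(2) less_cSUP_iff[of UNIV "\<lambda>k. D k - e" 0] unfolding c_gap_def eq by auto
    then show thesis using that D_call by auto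
  qed
  then have "e < D k" using D_call[of k] by simp
  also have "\<dots> \<le> p_gap \<mu> \<nu>" using le[of k] by (simp add: D_def)
  finally have e: "e < p_gap \<mu> \<nu>" .
  then show "(LINT x|\<nu>. x) - (LINT x|\<mu>. x) < p_gap \<mu> \<nu>" by (simp add: e_def)
  have S: "{k. shifted_put \<mu> \<nu> k = put_fun \<mu> k} = {k. D k = (SUP k. D k)}"
    unfolding shifted_put_def p D_def[symmetric] by (auto simp: D_def p_gap_def)
  note A = sup_attained_between_limits[OF cont lim, folded p, OF pos(1) e]
  show "put_fun \<mu> (x_minus \<mu> \<nu>) - put_fun \<nu> (x_minus \<mu> \<nu>) = p_gap \<mu> \<nu>"
    "put_fun \<mu> (x_plus \<mu> \<nu>) - put_fun \<nu> (x_plus \<mu> \<nu>) = p_gap \<mu> \<nu>"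
    "x_minus \<mu> \<nu> \<le> x_plus \<mu> \<nu>"
    using A unfolding x_minus_def x_plus_def S p[symmetric] by (simp_all add: D_def)
qed

text \<open>Clamping adds \<open>put_fun \<mu> c\<close> to the mean and subtracts
  \<open>call_fun \<mu> d\<close>; the value prescribed for the latter, which is the call gap
  written in terms of \<open>p\<close>, makes the means agree. The image has put function 0 up to
  \<open>c\<close>, \<open>put_fun \<mu> k - p\<close> up to \<open>d\<close>, and an affine one
  beyond; these lie below \<open>put_fun \<nu>\<close> because that is nonnegative, by the choice of
  \<open>p\<close>, and because \<open>call_fun \<nu>\<close> is nonnegative.\<close>

lemma clamp_dominated:
  assumes \<mu>: "\<mu> \<in> \<M>" and \<nu>: "\<nu> \<in> \<M>" and mass: "measure \<mu> UNIV = measure \<nu> UNIV"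
    and le: "\<And>k. put_fun \<mu> k - put_fun \<nu> k \<le> p" and cd: "c \<le> d"
    and c: "put_fun \<mu> c = p" and d: "call_fun \<mu> d = p - ((LINT x|\<nu>. x) - (LINT x|\<mu>. x))"
  shows "dominated_map \<mu> \<nu> (\<lambda>x. max c (min d x))"
proof -
  note D = finite_first_moment_measuresD[OF \<mu>] and E = finite_first_moment_measuresD[OF \<nu>]
  note i = integrable_put_call[OF D(3,4)]
  have eq: "max c (min d x) = x + max (c - x) 0 - max (x - d) 0" for x
    using cd by (auto simp: max_def min_def)
  have int: "integrable \<mu> (\<lambda>x. max c (min d x))"
    unfolding eq using i D(4) by simp
  have mean: "(LINT x|\<mu>. max c (min d x)) = (LINT x|\<nu>. x)"
    unfolding eq using i D(4) c d by (simp add: put_fun_def call_fun_def)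
  have "(LINT x|\<mu>. max (k - max c (min d x)) 0) \<le> put_fun \<nu> k" for k
  proof -
    consider "k \<le> c" | "c \<le> k" "k \<le> d" | "d \<le> k" by linarith
    then show ?thesis
    proof cases
      case 1
      then have "(LINT x|\<mu>. max (k - max c (min d x)) 0) = (LINT x|\<mu>. 0)"
        by (intro Bochner_Integration.integral_cong) auto
      then show ?thesis using put_fun_nonneg[of \<nu> k] by simp
    next
      case 2
      then have "(LINT x|\<mu>. max (k - max c (min d x)) 0) = (LINT x|\<mu>. max (k - x) 0 - max (c - x) 0)"
        by (intro Bochner_Integration.integral_cong) (auto simp: max_def min_def)
      also have "\<dots> = put_fun \<mu> k - p"
        using i c by (simp add: put_fun_def)
      finally show ?thesis using le[of k] by simp
    next
      case 3
      then have "(LINT x|\<mu>. max (k - max c (min d x)) 0) = (LINT x|\<mu>. k - max c (min d x))"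
        using cd by (intro Bochner_Integration.integral_cong) (auto simp: max_def min_def)
      also have "\<dots> = k * measure \<nu> UNIV - (LINT x|\<nu>. x)"
        using int mean mass D(2) finite_measure.integrable_const[OF D(3), of k] by (simp add: mult.commute)
      also have "\<dots> \<le> put_fun \<nu> k"
        using put_fun_eq_call_fun[OF \<nu>, of k] call_fun_nonneg[of \<nu> k] by simp
      finally show ?thesis .
    qed
  qed
  with int mean mass show ?thesis
    by (simp add: dominated_map_def)
qed

lemma optimal_map_upward_shift:
  assumes \<mu>: "\<mu> \<in> \<M>" and \<nu>: "\<nu> \<in> \<M>" and mass: "measure \<mu> UNIV = measure \<nu> UNIV"
    and pos: "0 < p_gap \<mu> \<nu>" "0 < c_gap \<mu> \<nu>" and W: "optimal_map \<mu> \<nu> W"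
  shows "(LINT x|\<mu>. max (W x - x) 0) \<le> p_gap \<mu> \<nu>"
proof -
  let ?p = "p_gap \<mu> \<nu>" and ?a = "x_minus \<mu> \<nu>" and ?b = "x_plus \<mu> \<nu>"
  let ?e = "(LINT x|\<nu>. x) - (LINT x|\<mu>. x)"
  note G = gap_attained[OF \<mu> \<nu> mass pos]
  \<comment> \<open>The put function of \<mu> rises from 0 at -\<infinity> to at least
    \<open>?p\<close> at \<open>?a\<close>, so \<open>c\<close> can be found to the left of
    \<open>?a\<close>. By the same argument for the call function \<open>d\<close> lies to the right
    of \<open>?b\<close>; hence c \<le> d.\<close>
  have "eventually (\<lambda>k. put_fun \<mu> k < ?p) at_bot"
    by (rule order_tendstoD(2)[OF put_fun_at_bot[OF \<mu>] pos(1)])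
  from eventually_conj[OF this eventually_le_at_bot[of ?a]]
  obtain K where K: "put_fun \<mu> K < ?p" "K \<le> ?a"
    by (auto simp: eventually_at_bot_linorder)
  have "?p \<le> put_fun \<mu> ?a"
    using G(2) put_fun_nonneg[of \<nu> ?a] by simp
  then obtain c where c: "c \<le> ?a" "put_fun \<mu> c = ?p"
    using IVT'[of "put_fun \<mu>" K ?p ?a] K
      continuous_on_subset[OF continuous_put_fun[OF \<mu>]] by auto
  have "eventually (\<lambda>k. call_fun \<mu> k < ?p - ?e) at_top"
    using G(5) by (intro order_tendstoD(2)[OF call_fun_at_top[OF \<mu>]]) simp
  from eventually_conj[OF this eventually_ge_at_top[of ?b]]
  obtain K' where K': "call_fun \<mu> K' < ?p - ?e" "?b \<le> K'"
    by (auto simp: eventually_at_top_linorder)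
  have "?p - ?e \<le> call_fun \<mu> ?b"
    using G(3) call_fun_nonneg[of \<nu> ?b] put_fun_eq_call_fun[OF \<mu>, of ?b] put_fun_eq_call_fun[OF \<nu>, of ?b] mass
    by simp
  then obtain d where d: "?b \<le> d" "call_fun \<mu> d = ?p - ?e"
    using IVT2'[of "call_fun \<mu>" K' "?p - ?e" ?b] K'
      continuous_on_subset[OF continuous_call_fun[OF \<mu>]] by auto
  have cd: "c \<le> d" using c d G(4) by simp
  define S where "S x = max c (min d x)" for x
  have "dominated_map \<mu> \<nu> S"
    unfolding S_def[abs_def] by (rule clamp_dominated[OF \<mu> \<nu> mass G(1) cd c(2) d(2)])
  then have "(LINT x|\<mu>. hinge (-1) 0 (x - W x)) \<le> (LINT x|\<mu>. hinge (-1) 0 (x - S x))"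
    by (intro optimal_map_minimises_hinge[OF \<mu> \<nu> W]) simp_all
  also have "\<dots> = (LINT x|\<mu>. max (c - x) 0)"
    using cd by (intro Bochner_Integration.integral_cong) (auto simp: hinge_def S_def max_def min_def)
  also have "\<dots> = ?p" using c(2) by (simp add: put_fun_def)
  finally show ?thesis by (simp add: hinge_def)
qed

text \<open>
  The put functions of \<open>\<mu>\<close> and of its image under \<open>W\<close> differ at \<open>k\<close> by at least \<open>p\<close>, while pointwise
  \<open>(k - x)\<^sup>+ - (k - W x)\<^sup>+ \<le> (W x - x)\<^sup>+\<close>. So equality holds almost everywhere.
\<close>

lemma sandwich_at_maximal_gap:
  assumes \<mu>: "\<mu> \<in> \<M>" and W: "dominated_map \<mu> \<nu> W"
    and le: "(LINT x|\<mu>. max (W x - x) 0) \<le> p" and k: "put_fun \<mu> k - put_fun \<nu> k = p"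
  shows "AE x in \<mu>. (x \<le> k \<longrightarrow> x \<le> W x \<and> W x \<le> k) \<and> (k \<le> x \<longrightarrow> k \<le> W x \<and> W x \<le> x)"
    "(LINT x|\<mu>. max (k - W x) 0) = put_fun \<nu> k"
proof -
  note D = finite_first_moment_measuresD[OF \<mu>]
  have Wi: "integrable \<mu> W" and dom: "(LINT x|\<mu>. max (k - W x) 0) \<le> put_fun \<nu> k"
    using W by (auto simp: dominated_map_def)
  \<comment> \<open>The slack of the pointwise estimate. If W x leaves the interval between x and k,
    the slack is its distance to that interval.\<close>
  define g where "g x = max (W x - x) 0 - (max (k - x) 0 - max (k - W x) 0)" for x
  have "integrable \<mu> (\<lambda>x. W x - x)" using Wi D(4) by simp
  from integrable_put_call(2)[OF D(3) this, of 0]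
  have i: "integrable \<mu> (\<lambda>x. max (W x - x) 0)" by simp
  note i = i integrable_put_call(1)[OF D(3,4), of k] integrable_put_call(1)[OF D(3) Wi, of k]
  have gi: "integrable \<mu> g" unfolding g_def[abs_def] using i by simp
  have g: "(LINT x|\<mu>. g x) = (LINT x|\<mu>. max (W x - x) 0) - (put_fun \<mu> k - (LINT x|\<mu>. max (k - W x) 0))"
    unfolding g_def put_fun_def using i by simp
  have nn: "0 \<le> g x" for x
    unfolding g_def by (auto simp: max_def)
  have "0 \<le> (LINT x|\<mu>. g x)"
    using nn by (rule Bochner_Integration.integral_nonneg)
  then show "(LINT x|\<mu>. max (k - W x) 0) = put_fun \<nu> k"
    and "AE x in \<mu>. (x \<le> k \<longrightarrow> x \<le> W x \<and> W x \<le> k) \<and> (k \<le> x \<longrightarrow> k \<le> W x \<and> W x \<le> x)"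
  proof -
    assume pos: "0 \<le> (LINT x|\<mu>. g x)"
    then show "(LINT x|\<mu>. max (k - W x) 0) = put_fun \<nu> k"
      using g le k dom by linarith
    have "(LINT x|\<mu>. g x) = 0"
      using pos g le k dom by linarith
    then have "AE x in \<mu>. g x = 0"
      using integral_nonneg_eq_0_iff_AE[OF gi] nn by simp
    then show "AE x in \<mu>. (x \<le> k \<longrightarrow> x \<le> W x \<and> W x \<le> k) \<and> (k \<le> x \<longrightarrow> k \<le> W x \<and> W x \<le> x)"
      by eventually_elim (auto simp: g_def max_def split: if_splits)
  qed
qed

theorem proposition3p1:
  fixes \<mu> \<nu> :: "real measure" and Tstar Tminus Tplus :: "real \<Rightarrow> real"
  assumes "\<mu> \<in> \<M>" and "\<nu> \<in> \<M>"
    and "emeasure \<mu> UNIV = emeasure \<nu> UNIV"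
    and "min (p_gap \<mu> \<nu>) (c_gap \<mu> \<nu>) > 0"
    and "optimal_map \<mu> \<nu> Tstar"
    and "optimal_map (eta_minus \<mu> \<nu>) (chi_minus \<mu> \<nu>) Tminus"
    and "optimal_map (eta_plus \<mu> \<nu>) (chi_plus \<mu> \<nu>) Tplus"
  shows "AE x in \<mu>. Tstar x = glued_map \<mu> \<nu> Tminus Tplus x"
proof -
  let ?a = "x_minus \<mu> \<nu>" and ?b = "x_plus \<mu> \<nu>"
  note \<mu> = assms(1) and \<nu> = assms(2) and W = assms(5)
  have mass: "measure \<mu> UNIV = measure \<nu> UNIV"
    using assms(3) by (simp add: measure_def)
  have pos: "0 < p_gap \<mu> \<nu>" "0 < c_gap \<mu> \<nu>"
    using assms(4) by auto
  note G = gap_attained[OF \<mu> \<nu> mass pos]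
  have Wd: "dominated_map \<mu> \<nu> Tstar" by (rule optimal_map_dominated[OF \<mu> \<nu> W])
  note shift = optimal_map_upward_shift[OF \<mu> \<nu> mass pos W]
  note Sa = sandwich_at_maximal_gap[OF \<mu> Wd shift G(2)]
  note Sb = sandwich_at_maximal_gap[OF \<mu> Wd shift G(3)]
  have shifted: "shifted_put \<mu> \<nu> = (\<lambda>k. put_fun \<nu> k + p_gap \<mu> \<nu>)"
    by (simp add: shifted_put_def[abs_def])
  \<comment> \<open>Left slopes are masses of open half-lines, so the atom supplies exactly the mass
    that \<nu> lacks to the left of \<open>?a\<close>.\<close>
  have wa: "Delta_minus \<mu> \<nu> - left_deriv (shifted_put \<mu> \<nu>) ?a = measure \<mu> {..<?a} - measure \<nu> {..<?a}"
    unfolding Delta_minus_def shifted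
    using left_deriv_put_fun[OF \<mu>, of 0] left_deriv_put_fun[OF \<nu>] by simp
  have compl: "measure \<eta> {x<..} = measure \<eta> UNIV - measure \<eta> {..x}" if \<eta>: "\<eta> \<in> \<M>" for \<eta> x
  proof -
    note D = finite_first_moment_measuresD[OF \<eta>]
    have "{x<..} = space \<eta> - {..x}" using D(2) by auto
    then show ?thesis
      using finite_measure.finite_measure_compl[OF D(3), of "{..x}"] D(1,2) by simp
  qed
  \<comment> \<open>Right slopes are masses of closed lower half-lines; passing to complements
    reverses the difference because the total masses agree.\<close>
  have wb: "right_deriv (shifted_put \<mu> \<nu>) ?b - Delta_plus \<mu> \<nu> = measure \<mu> {?b<..} - measure \<nu> {?b<..}"
    unfolding Delta_plus_def shifted compl[OF \<mu>] compl[OF \<nu>]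
    using right_deriv_put_fun[OF \<mu>, of 0] right_deriv_put_fun[OF \<nu>] mass by simp
  have wa_pos: "0 \<le> measure \<mu> {..<?a} - measure \<nu> {..<?a}"
    using measures_at_maximal_gap(1)[OF \<mu> \<nu>, of ?a] G(1,2) by simp
  have wb_pos: "0 \<le> measure \<mu> {?b<..} - measure \<nu> {?b<..}"
    using measures_at_maximal_gap(2)[OF \<mu> \<nu>, of ?b] G(1,3) mass compl[OF \<mu>] compl[OF \<nu>] by simp
  have "AE x in \<mu>. (x < ?a \<longrightarrow> Tstar x \<le> ?a) \<and> (?a \<le> x \<longrightarrow> ?a \<le> Tstar x)"
    using Sa(1) by eventually_elim auto
  note lower = lower_split[OF \<mu> \<nu> Wd this Sa(2) wa_pos refl]
  have "AE x in \<mu>. (?b < x \<longrightarrow> ?b \<le> Tstar x) \<and> (x \<le> ?b \<longrightarrow> Tstar x \<le> ?b)"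
    using Sb(1) by eventually_elim auto
  note upper = upper_split[OF \<mu> \<nu> Wd this Sb(2) wb_pos refl]
  have below: "AE x in \<mu>. x \<in> {..<?a} \<longrightarrow> Tstar x = Tminus x"
    using assms(6) unfolding eta_minus_def chi_minus_def wa
    by (intro optimal_map_eq_on[OF \<mu> \<nu> lower(1) _ W _ lower(2,3)]) simp_all
  have above: "AE x in \<mu>. x \<in> {?b<..} \<longrightarrow> Tstar x = Tplus x"
    using assms(7) unfolding eta_plus_def chi_plus_def wb
    by (intro optimal_map_eq_on[OF \<mu> \<nu> upper(1) _ W _ upper(2,3)]) simp_all
  \<comment> \<open>On the middle interval the sandwich at \<open>?a\<close> gives
    \<open>Tstar x \<le> x\<close> and the one at \<open>?b\<close> gives
    \<open>x \<le> Tstar x\<close>.\<close>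
  from below above Sa(1) Sb(1) show ?thesis
    by eventually_elim (auto simp: glued_map_def intro: antisym)
qed

end
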